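(* Assume that $B=\beta^{-1}\alpha$ is bounded. Then $$\Gamma_0(A_{\alpha\beta}-zI)^{-1}=\Theta_B(z)^{-1}\,\Gamma_0(L-zI)^{-1}\qquad\forall z\in\mathbb C_-\cap\mathcal Q_B,$$ $$\Gamma_0(A_{\alpha\beta}-zI)^{-1}=\widehat\Theta_B(z)^{-1}\,\Gamma_0(L^*-zI)^{-1}\qquad\forall z\in\mathbb C_+\cap\mathcal Q_B,$$ where $\Theta_B$ and $\widehat\Theta_B$ are defined via their inverses: $$\Theta_B(z)^{-1}=2\mathrm{i}\,Q_B(z)\bigl(I-S^*(\bar z)\bigr)^{-1},\quad z\in\mathbb C_-\cap\mathcal Q_B,$$ $$\widehat\Theta_B(z)^{-1}=-2\mathrm{i}\,Q_B(z)\bigl(I-S(z)\bigr)^{-1},\quad z\in\mathbb C_+\cap\mathcal Q_B.$$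
   Context: Setting. Let $\mathcal H$ be a separable Hilbert space, $A_0$ a self-adjoint operator in $\mathcal H$ with $0\in\rho(A_0)$, $\mathcal E$ an auxiliary Hilbert space, $\Pi:\mathcal E\to\mathcal H$ a bounded operator with $\operatorname{dom}(A_0)\cap\operatorname{ran}(\Pi)=\{0\}$ and $\ker(\Pi)=\{0\}$, and $\Lambda$ a (possibly unbounded) self-adjoint operator in $\mathcal E$. Define operators $A,\Gamma_0$ on $\operatorname{dom}(A)=\operatorname{dom}(\Gamma_0):=\operatorname{dom}(A_0)\dotplus\operatorname{ran}(\Pi)$ by $A(A_0^{-1}f+\Pi\phi):=f$, $\Gamma_0(A_0^{-1}f+\Pi\phi):=\phi$ ($f\in\mathcal H$, $\phi\in\mathcal E$), and $\Gamma_1$ on $\operatorname{dom}(\Gamma_1):=\operatorname{dom}(A_0)\dotplus\Pi\operatorname{dom}(\Lambda)$ by $\Gamma_1(A_0^{-1}f+\Pi\phi):=\Pi^*f+\Lambda\phi$. For $z\in\rho(A_0)$ put $\gamma(z):=(I-zA_0^{-1})^{-1}\Pi$ and $M(z):=\Gamma_1\gamma(z)=\Lambda+z\Pi^*(I-zA_0^{-1})^{-1}\Pi$ with $\operatorname{dom}(M(z))=\operatorname{dom}(\Lambda)$. Boundary conditions. $\alpha,\beta$ are linear operators in $\mathcal E$ such that $\operatorname{dom}(\alpha)\supset\operatorname{dom}(\Lambda)$, $\beta$ is bounded and boundedly invertible on $\mathcal E$, and $\alpha+\beta\Lambda$ is closable; $B:=\beta^{-1}\alpha$. Put $\mathcal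 Q_B:=\{z\in\rho(A_0):0\in\rho(\overline{B+M(z)})\}$ and $Q_B(z):=-(\overline{B+M(z)})^{-1}$ for $z\in\mathcal Q_B$ (overline denotes operator closure). It is assumed that $\mathcal Q_B\ne\emptyset$; then $A_{\alpha\beta}$ is the closed densely defined operator in $\mathcal H$, with $\widetilde A\subset A_{\alpha\beta}\subset A$ (where $\widetilde A$ is the restriction of $A_0$ to $\operatorname{dom}(A_0)\cap\ker\Gamma_1$), whose resolvent for $z\in\mathcal Q_B\subset\rho(A_{\alpha\beta})$ is $$(A_{\alpha\beta}-zI)^{-1}=(A_0-zI)^{-1}-(I-zA_0^{-1})^{-1}\Pi\bigl(\overline{B+M(z)}\bigr)^{-1}\Pi^*(I-zA_0^{-1})^{-1}.$$ It is the realisation of $A$ with boundary condition $(\alpha\Gamma_0+\beta\Gamma_1)u=0$. The operator $L:=A_{-\mathrm{i}I,\,I}$ (that is, $\alpha=-\mathrm{i}I$, $\beta=I$) is the restriction of $A$ to $\{u\in\operatorname{dom}(\Gamma_1):\Gamma_1u=\mathrm{i}\Gamma_0u\}$; it is maximal dissipative, so $\mathbb C_-\subset\rho(L)$, and $L^*=A_{\mathrm{i}I,\,I}$, $\mathbb C_+\subset\rho(L^* )$. Characteristic function. $S(z):=I-2\mathrm{i}(M(z)+\mathrm{i}I)^{-1}$ for $z\in\mathbb C_+$, and $S^*(\bar z):=[S(\bar z)]^*=I+2\mathrm{i}(M(z)-\mathrm{i}I)^{-1}$ for $z\in\mathbb C_-$. The inverses $(I-S^*(\bar z))^{-1}$ and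 $(I-S(z))^{-1}$ are (in general unbounded) operators with domain $\operatorname{dom}(\Lambda)$. *)

theory Defs
  imports "HOL-Analysis.Analysis"
begin

section \<open>Complex Hilbert spaces\<close>

text \<open>
  A complex Hilbert space is a complete real inner product space with a compatible complex
  structure.  The complex inner product is linear in its first argument, and its real part
  is the real inner product, so norm and topology are the ones of \<^class>\<open>real_inner\<close>.
\<close>

class chilbert_space = real_inner + complete_space +
  fixes scaleC :: "complex \<Rightarrow> 'a \<Rightarrow> 'a"  (infixr "*\<^sub>C" 75)
    and cinner :: "'a \<Rightarrow> 'a \<Rightarrow> complex"
  assumes scaleC_add_right: "c *\<^sub>C (x + y) = c *\<^sub>C x + c *\<^sub>C y"
    and scaleC_add_left: "(c + d) *\<^sub>C x = c *\<^sub>C x + d *\<^sub>C x"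
    and scaleC_scaleC: "c *\<^sub>C d *\<^sub>C x = (c * d) *\<^sub>C x"
    and scaleR_eq_scaleC: "scaleR r x = complex_of_real r *\<^sub>C x"
    and cinner_commute: "cinner x y = cnj (cinner y x)"
    and cinner_add_left: "cinner (x + y) z = cinner x z + cinner y z"
    and cinner_scaleC_left: "cinner (c *\<^sub>C x) y = c * cinner x y"
    and inner_eq_Re_cinner: "inner x y = Re (cinner x y)"

abbreviation upper_half_plane :: "complex set"  ("\<complex>\<^sub>+")
  where "\<complex>\<^sub>+ \<equiv> {z. 0 < Im z}"

abbreviation lower_half_plane :: "complex set"  ("\<complex>\<^sub>-")
  where "\<complex>\<^sub>- \<equiv> {z. Im z < 0}"


section \<open>Unbounded operators\<close>

text \<open>
  An operator is identified with its graph.  Hence domain and range are \<^const>\<open>Domain\<close> and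
  \<^const>\<open>Range\<close>, the inverse is \<^const>\<open>converse\<close>, inclusion of operators is
  inclusion of sets, the closure of an operator is the topological \<^const>\<open>closure\<close> of its graph
  in the product space, and an operator is closed if its graph is.  Equality of operators
  includes equality of their domains.  Sums and compositions have their maximal domains.
\<close>

type_synonym ('a, 'b) lop = "('a \<times> 'b) set"

definition linear_op :: "('a::chilbert_space, 'b::chilbert_space) lop \<Rightarrow> bool" where
  "linear_op T \<longleftrightarrow>
     single_valued T \<and> (0, 0) \<in> T \<and>
     (\<forall>x y x' y'. (x, y) \<in> T \<longrightarrow> (x', y') \<in> T \<longrightarrow> (x + x', y + y') \<in> T) \<and>
     (\<forall>c x y. (x, y) \<in> T \<longrightarrow> (c *\<^sub>C x, c *\<^sub>C y) \<in> T)"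

definition op_plus :: "('a::chilbert_space, 'b::chilbert_space) lop \<Rightarrow> ('a, 'b) lop \<Rightarrow> ('a, 'b) lop"
    (infixl "+\<^sub>o" 65)
  where "S +\<^sub>o T = {(x, y + y') | x y y'. (x, y) \<in> S \<and> (x, y') \<in> T}"

definition op_minus :: "('a::chilbert_space, 'b::chilbert_space) lop \<Rightarrow> ('a, 'b) lop \<Rightarrow> ('a, 'b) lop"
    (infixl "-\<^sub>o" 65)
  where "S -\<^sub>o T = {(x, y - y') | x y y'. (x, y) \<in> S \<and> (x, y') \<in> T}"

definition op_scale :: "complex \<Rightarrow> ('a::chilbert_space, 'b::chilbert_space) lop \<Rightarrow> ('a, 'b) lop"
    (infixr "*\<^sub>o" 70)
  where "c *\<^sub>o T = {(x, c *\<^sub>C y) | x y. (x, y) \<in> T}"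

abbreviation op_comp :: "('b::chilbert_space, 'c::chilbert_space) lop
      \<Rightarrow> ('a::chilbert_space, 'b) lop \<Rightarrow> ('a, 'c) lop"
    (infixr "\<circ>\<^sub>o" 75)
  where "S \<circ>\<^sub>o T \<equiv> T O S"

definition op_ker :: "('a::chilbert_space, 'b::chilbert_space) lop \<Rightarrow> 'a set"
  where "op_ker T = {x. (x, 0) \<in> T}"

definition op_bounded :: "('a::chilbert_space, 'b::chilbert_space) lop \<Rightarrow> bool"
  where "op_bounded T \<longleftrightarrow> (\<exists>C. \<forall>(x, y) \<in> T. norm y \<le> C * norm x)"

text \<open>
  \<^const>\<open>op_bounded\<close> refers only to the domain of the operator, which may be a proper subspace.
\<close>

definition bounded_everywhere :: "('a::chilbert_space, 'b::chilbert_space) lop \<Rightarrow> bool"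
  where "bounded_everywhere T \<longleftrightarrow> linear_op T \<and> Domain T = UNIV \<and> op_bounded T"

definition closable_op :: "('a::chilbert_space, 'b::chilbert_space) lop \<Rightarrow> bool"
  where "closable_op T \<longleftrightarrow> linear_op (closure T)"

definition densely_defined :: "('a::chilbert_space, 'b::chilbert_space) lop \<Rightarrow> bool"
  where "densely_defined T \<longleftrightarrow> closure (Domain T) = UNIV"

definition adjoint_op :: "('a::chilbert_space, 'b::chilbert_space) lop \<Rightarrow> ('b, 'a) lop"
  where "adjoint_op T = {(y, x'). \<forall>(x, w) \<in> T. cinner w y = cinner x x'}"

definition selfadjoint_op :: "('a::chilbert_space, 'a) lop \<Rightarrow> bool"
  where "selfadjoint_op T \<longleftrightarrow> linear_op T \<and> densely_defined T \<and> adjoint_op T = T"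

definition resolvent :: "('a::chilbert_space, 'a) lop \<Rightarrow> complex \<Rightarrow> ('a, 'a) lop"
  where "resolvent T z = (T -\<^sub>o z *\<^sub>o Id)\<inverse>"

definition resolvent_set :: "('a::chilbert_space, 'a) lop \<Rightarrow> complex set"
  where "resolvent_set T = {z. bounded_everywhere (resolvent T z)}"


section \<open>The boundary operators and the M-function\<close>

text \<open>
  \<open>P\<close> stands for the bounded operator from the auxiliary space into the main space that is
  usually written with a capital Pi, a symbol that is reserved for dependent function spaces.
\<close>

definition A_op :: "('h::chilbert_space, 'h) lop \<Rightarrow> ('e::chilbert_space, 'h) lop \<Rightarrow> ('h, 'h) lop"
  where "A_op A\<^sub>0 P = {(u + v, f) | u v f \<phi>. (f, u) \<in> A\<^sub>0\<inverse> \<and> (\<phi>, v) \<in> P}"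

definition Gamma0 :: "('h::chilbert_space, 'h) lop \<Rightarrow> ('e::chilbert_space, 'h) lop \<Rightarrow> ('h, 'e) lop"
  where "Gamma0 A\<^sub>0 P = {(u + v, \<phi>) | u v f \<phi>. (f, u) \<in> A\<^sub>0\<inverse> \<and> (\<phi>, v) \<in> P}"

definition Gamma1 :: "('h::chilbert_space, 'h) lop \<Rightarrow> ('e::chilbert_space, 'h) lop
    \<Rightarrow> ('e, 'e) lop \<Rightarrow> ('h, 'e) lop"
  where "Gamma1 A\<^sub>0 P \<Lambda> = {(u + v, g + l) | u v f \<phi> g l.
      (f, u) \<in> A\<^sub>0\<inverse> \<and> (\<phi>, v) \<in> P \<and> (f, g) \<in> adjoint_op P \<and> (\<phi>, l) \<in> \<Lambda>}"

definition A_tilde :: "('h::chilbert_space, 'h) lop \<Rightarrow> ('e::chilbert_space, 'h) lop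
    \<Rightarrow> ('e, 'e) lop \<Rightarrow> ('h, 'h) lop"
  where "A_tilde A\<^sub>0 P \<Lambda> = {(u, f) \<in> A\<^sub>0. u \<in> op_ker (Gamma1 A\<^sub>0 P \<Lambda>)}"

definition gamma_field :: "('h::chilbert_space, 'h) lop \<Rightarrow> ('e::chilbert_space, 'h) lop
    \<Rightarrow> complex \<Rightarrow> ('e, 'h) lop"
  where "gamma_field A\<^sub>0 P z = (Id -\<^sub>o z *\<^sub>o A\<^sub>0\<inverse>)\<inverse> \<circ>\<^sub>o P"

definition M_fun :: "('h::chilbert_space, 'h) lop \<Rightarrow> ('e::chilbert_space, 'h) lop
    \<Rightarrow> ('e, 'e) lop \<Rightarrow> complex \<Rightarrow> ('e, 'e) lop"
  where "M_fun A\<^sub>0 P \<Lambda> z = Gamma1 A\<^sub>0 P \<Lambda> \<circ>\<^sub>o gamma_field A\<^sub>0 P z"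


section \<open>Realisations\<close>

definition B_op :: "('e::chilbert_space, 'e) lop \<Rightarrow> ('e, 'e) lop \<Rightarrow> ('e, 'e) lop"
  where "B_op \<alpha> \<beta> = \<beta>\<inverse> \<circ>\<^sub>o \<alpha>"

definition BM_closure :: "('h::chilbert_space, 'h) lop \<Rightarrow> ('e::chilbert_space, 'h) lop
    \<Rightarrow> ('e, 'e) lop \<Rightarrow> ('e, 'e) lop \<Rightarrow> ('e, 'e) lop \<Rightarrow> complex \<Rightarrow> ('e, 'e) lop"
  where "BM_closure A\<^sub>0 P \<Lambda> \<alpha> \<beta> z = closure (B_op \<alpha> \<beta> +\<^sub>o M_fun A\<^sub>0 P \<Lambda> z)"

definition Q_set :: "('h::chilbert_space, 'h) lop \<Rightarrow> ('e::chilbert_space, 'h) lop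
    \<Rightarrow> ('e, 'e) lop \<Rightarrow> ('e, 'e) lop \<Rightarrow> ('e, 'e) lop \<Rightarrow> complex set"
  where "Q_set A\<^sub>0 P \<Lambda> \<alpha> \<beta> =
    {z \<in> resolvent_set A\<^sub>0. 0 \<in> resolvent_set (BM_closure A\<^sub>0 P \<Lambda> \<alpha> \<beta> z)}"

definition Q_fun :: "('h::chilbert_space, 'h) lop \<Rightarrow> ('e::chilbert_space, 'h) lop
    \<Rightarrow> ('e, 'e) lop \<Rightarrow> ('e, 'e) lop \<Rightarrow> ('e, 'e) lop \<Rightarrow> complex \<Rightarrow> ('e, 'e) lop"
  where "Q_fun A\<^sub>0 P \<Lambda> \<alpha> \<beta> z = (- 1) *\<^sub>o (BM_closure A\<^sub>0 P \<Lambda> \<alpha> \<beta> z)\<inverse>"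

text \<open>
  The operator with boundary condition
  \<open>(\<alpha> \<Gamma>\<^sub>0 + \<beta> \<Gamma>\<^sub>1) u = 0\<close>, characterised by the Krein resolvent formula.
  The description is meaningful only if \<^term>\<open>Q_set A\<^sub>0 P \<Lambda> \<alpha> \<beta>\<close> is nonempty:
  the resolvent at a single point then determines the operator.
\<close>

definition realisation :: "('h::chilbert_space, 'h) lop \<Rightarrow> ('e::chilbert_space, 'h) lop
    \<Rightarrow> ('e, 'e) lop \<Rightarrow> ('e, 'e) lop \<Rightarrow> ('e, 'e) lop \<Rightarrow> ('h, 'h) lop"
  where "realisation A\<^sub>0 P \<Lambda> \<alpha> \<beta> = (THE T.
    linear_op T \<and> closed T \<and> densely_defined T \<and>
    A_tilde A\<^sub>0 P \<Lambda> \<subseteq> T \<and> T \<subseteq> A_op A\<^sub>0 P \<and>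
    (\<forall>z \<in> Q_set A\<^sub>0 P \<Lambda> \<alpha> \<beta>. z \<in> resolvent_set T \<and>
       resolvent T z = resolvent A\<^sub>0 z -\<^sub>o
         (Id -\<^sub>o z *\<^sub>o A\<^sub>0\<inverse>)\<inverse> \<circ>\<^sub>o P \<circ>\<^sub>o (BM_closure A\<^sub>0 P \<Lambda> \<alpha> \<beta> z)\<inverse>
           \<circ>\<^sub>o adjoint_op P \<circ>\<^sub>o (Id -\<^sub>o z *\<^sub>o A\<^sub>0\<inverse>)\<inverse>))"

definition L_op :: "('h::chilbert_space, 'h) lop \<Rightarrow> ('e::chilbert_space, 'h) lop
    \<Rightarrow> ('e, 'e) lop \<Rightarrow> ('h, 'h) lop"
  where "L_op A\<^sub>0 P \<Lambda> = realisation A\<^sub>0 P \<Lambda> ((- \<i>) *\<^sub>o Id) Id"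


section \<open>Characteristic function\<close>

text \<open>
  \<^term>\<open>S_star A\<^sub>0 P \<Lambda> w\<close> is the adjoint of the value of the characteristic function at
  \<open>w\<close>, so for \<open>z\<close> in the lower half-plane it is evaluated at \<open>w = cnj z\<close>.
  \<open>Theta\<close> and \<open>Theta_hat\<close> are defined via their inverses.
\<close>

definition S_fun :: "('h::chilbert_space, 'h) lop \<Rightarrow> ('e::chilbert_space, 'h) lop
    \<Rightarrow> ('e, 'e) lop \<Rightarrow> complex \<Rightarrow> ('e, 'e) lop"
  where "S_fun A\<^sub>0 P \<Lambda> z = Id -\<^sub>o (2 * \<i>) *\<^sub>o (M_fun A\<^sub>0 P \<Lambda> z +\<^sub>o \<i> *\<^sub>o Id)\<inverse>"

definition S_star :: "('h::chilbert_space, 'h) lop \<Rightarrow> ('e::chilbert_space, 'h) lop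
    \<Rightarrow> ('e, 'e) lop \<Rightarrow> complex \<Rightarrow> ('e, 'e) lop"
  where "S_star A\<^sub>0 P \<Lambda> w = adjoint_op (S_fun A\<^sub>0 P \<Lambda> w)"

definition Theta :: "('h::chilbert_space, 'h) lop \<Rightarrow> ('e::chilbert_space, 'h) lop
    \<Rightarrow> ('e, 'e) lop \<Rightarrow> ('e, 'e) lop \<Rightarrow> ('e, 'e) lop \<Rightarrow> complex \<Rightarrow> ('e, 'e) lop"
  where "Theta A\<^sub>0 P \<Lambda> \<alpha> \<beta> z =
    ((2 * \<i>) *\<^sub>o (Q_fun A\<^sub>0 P \<Lambda> \<alpha> \<beta> z \<circ>\<^sub>o (Id -\<^sub>o S_star A\<^sub>0 P \<Lambda> (cnj z))\<inverse>))\<inverse>"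

definition Theta_hat :: "('h::chilbert_space, 'h) lop \<Rightarrow> ('e::chilbert_space, 'h) lop
    \<Rightarrow> ('e, 'e) lop \<Rightarrow> ('e, 'e) lop \<Rightarrow> ('e, 'e) lop \<Rightarrow> complex \<Rightarrow> ('e, 'e) lop"
  where "Theta_hat A\<^sub>0 P \<Lambda> \<alpha> \<beta> z =
    ((- 2 * \<i>) *\<^sub>o (Q_fun A\<^sub>0 P \<Lambda> \<alpha> \<beta> z \<circ>\<^sub>o (Id -\<^sub>o S_fun A\<^sub>0 P \<Lambda> z)\<inverse>))\<inverse>"

end

theory Submission
  imports Defs
begin

text \<open>
  Since \<open>B\<close> is bounded, \<open>B + M(z)\<close> is a bounded perturbation of the closed operator
  \<open>B + \<Lambda>\<close> and hence closed already.  Solving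
  \<open>(A - z) (A\<^sub>0\<inverse> f + \<Pi> \<phi>) = h\<close> under the boundary condition \<open>(B + \<Lambda>) \<phi> + \<Pi>\<^sup>* f = 0\<close>
  yields Krein's formula, and the coordinate \<open>\<phi>\<close> of the solution is
  \<open>\<Gamma>\<^sub>0 (A\<^sub>\<alpha>\<^sub>\<beta> - z)\<inverse> h = - (B + M(z))\<inverse> \<Pi>\<^sup>* (I - z A\<^sub>0\<inverse>)\<inverse> h\<close>.
  For \<open>B = \<plusminus>\<i>\<close>, with the sign of \<open>Im z\<close>, the imaginary part of \<open>M(z) + B\<close> is definite, so that
  \<open>M(z) \<plusminus> \<i>\<close> is boundedly invertible; this covers \<open>L\<close> and \<open>L\<^sup>*\<close>.  The inverse of
  \<open>I - S(z) = 2 \<i> (M(z) + \<i>)\<inverse>\<close> (and likewise of \<open>I - S\<^sup>*\<close>) then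
  cancels the factor \<open>(M(z) \<plusminus> \<i>)\<inverse>\<close> in the formula for \<open>L\<^sup>*\<close> and \<open>L\<close>.
\<close>

section \<open>Complex inner products\<close>

interpretation cvec: vector_space "scaleC :: complex \<Rightarrow> 'a \<Rightarrow> 'a::chilbert_space"
proof
  fix x :: 'a
  \<comment> \<open>The unit law is not an axiom of the class; it comes from the agreement of real
    and complex scaling at 1.\<close>
  have "1 *\<^sub>C x = complex_of_real 1 *\<^sub>C x" by simp
  also have "\<dots> = x" by (simp only: scaleR_eq_scaleC[symmetric]) simp
  finally show "1 *\<^sub>C x = x" .
qed (auto simp: scaleC_add_right scaleC_add_left scaleC_scaleC)

lemma cinner_add_right: "cinner x (y + z) = cinner x y + cinner x (z::'a::chilbert_space)"
  by (metis cinner_add_left cinner_commute complex_cnj_add)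

lemma cinner_scaleC_right: "cinner x (c *\<^sub>C y) = cnj c * cinner x (y::'a::chilbert_space)"
  by (metis cinner_commute cinner_scaleC_left complex_cnj_cnj complex_cnj_mult)

lemma scaleC_minus_one: "- x = (-1) *\<^sub>C (x::'a::chilbert_space)"
  by (simp add: cvec.scale_minus_left)

lemma cinner_minus_left: "cinner (- x) y = - cinner x (y::'a::chilbert_space)"
  unfolding scaleC_minus_one[of x] cinner_scaleC_left by simp

lemma cinner_minus_right: "cinner x (- y) = - cinner x (y::'a::chilbert_space)"
  unfolding scaleC_minus_one[of y] cinner_scaleC_right by simp

lemma cinner_diff_left: "cinner (x - y) z = cinner x z - cinner y (z::'a::chilbert_space)"
  using cinner_add_left[of x "- y" z] by (simp add: cinner_minus_left)

lemma cinner_diff_right: "cinner x (y - z) = cinner x y - cinner x (z::'a::chilbert_space)"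
  using cinner_add_right[of x y "- z"] by (simp add: cinner_minus_right)

lemmas cinner_simps = cinner_add_left cinner_add_right cinner_diff_left cinner_diff_right
  cinner_minus_left cinner_minus_right cinner_scaleC_left cinner_scaleC_right

lemma cinner_self: "cinner x x = complex_of_real ((norm (x::'a::chilbert_space))\<^sup>2)"
  using cinner_commute[of x x]
  by (simp add: complex_eq_iff power2_norm_eq_inner inner_eq_Re_cinner)

lemma norm_scaleC: "norm (c *\<^sub>C x) = norm c * norm (x::'a::chilbert_space)"
proof -
  have "complex_of_real ((norm (c *\<^sub>C x))\<^sup>2) = c * cnj c * complex_of_real ((norm x)\<^sup>2)"
    by (simp only: cinner_self[symmetric] cinner_scaleC_left cinner_scaleC_right mult_ac)
  also have "\<dots> = complex_of_real ((norm c * norm x)\<^sup>2)"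
    by (simp only: complex_norm_square[symmetric] power_mult_distrib of_real_mult)
  finally have "(norm (c *\<^sub>C x))\<^sup>2 = (norm c * norm x)\<^sup>2"
    using of_real_eq_iff by blast
  then show ?thesis
    by (simp add: power2_eq_iff_nonneg)
qed

text \<open>Rotation by -i turns the imaginary part into a real pairing, so that complex
  orthogonality, continuity and adjointness reduce to statements about \<open>inner\<close>.\<close>

lemma Im_cinner: "Im (cinner x y) = inner ((- \<i>) *\<^sub>C x) (y::'a::chilbert_space)"
  by (simp add: inner_eq_Re_cinner cinner_scaleC_left cvec.scale_minus_left cinner_minus_left)

lemma abs_Im_cinner_le: "\<bar>Im (cinner x y)\<bar> \<le> norm x * norm (y::'a::chilbert_space)"
  unfolding Im_cinner using Cauchy_Schwarz_ineq2[of "(- \<i>) *\<^sub>C x" y]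
  by (simp only: norm_scaleC) simp

lemma cinner_extensionality:
  assumes "\<And>x. cinner x u = cinner x (v::'a::chilbert_space)"
  shows "u = v"
proof -
  have "inner (u - v) (u - v) = 0"
    by (simp add: inner_eq_Re_cinner cinner_diff_right assms)
  then show ?thesis by simp
qed

lemma continuous_on_cinner_right:
  "continuous_on S (\<lambda>p. cinner x (f p :: 'a::chilbert_space))" if "continuous_on S f"
proof -
  have eq: "(\<lambda>p. cinner x (f p)) = (\<lambda>p. Complex (inner x (f p)) (inner ((- \<i>) *\<^sub>C x) (f p)))"
    by (rule ext) (simp add: complex_eq_iff inner_eq_Re_cinner Im_cinner del: cvec.scale_minus_left)
  show ?thesis
    unfolding eq Complex_eq using that by (intro continuous_intros)
qed


section \<open>Representation of functionals\<close>

text \<open>The representing vector minimises \<open>\<parallel>x\<parallel>\<^sup>2 - 2 f x\<close> on \<open>S\<close>; a minimising sequence is Cauchy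
  by the parallelogram law.\<close>

lemma riesz_on_subspace:
  fixes f :: "'a::{real_inner, complete_space} \<Rightarrow> real"
  assumes S: "subspace S" "closed S" and f: "bounded_linear f"
  shows "\<exists>v\<in>S. \<forall>s\<in>S. f s = inner s v"
proof -
  interpret f: bounded_linear f by (rule f)
  obtain C where C: "\<And>x. \<bar>f x\<bar> \<le> norm x * C"
    using f.bounded by auto
  define J where "J x = inner x x - 2 * f x" for x
  \<comment> \<open>Here \<open>C\<close> bounds \<open>f\<close>, and the estimate completes the
    square in the norm of \<open>x\<close>.\<close>
  have below: "- C\<^sup>2 \<le> J x" for x
  proof -
    have "0 \<le> (norm x - C)\<^sup>2" by simp
    then show ?thesis
      using C[of x] by (simp add: J_def power2_diff dot_square_norm algebra_simps abs_le_iff)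
  qed
  define m where "m = Inf (J ` S)"
  have bdd: "bdd_below (J ` S)" using below by (auto intro!: bdd_belowI)
  have "0 \<in> S" using S by (simp add: subspace_0)
  have m_le: "m \<le> J s" if "s \<in> S" for s
    unfolding m_def using bdd that by (auto intro: cInf_lower)
  have "\<exists>s\<in>S. J s < m + inverse (real (Suc n))" for n
  proof -
    have "\<exists>y\<in>J ` S. y < m + inverse (real (Suc n))"
      unfolding m_def using \<open>0 \<in> S\<close> bdd
      by (intro iffD1[OF cInf_less_iff]) auto
    then show ?thesis by auto
  qed
  then obtain X where X: "\<And>n. X n \<in> S" "\<And>n. J (X n) < m + inverse (real (Suc n))"
    by metis
  \<comment> \<open>The midpoint lies in \<open>S\<close>, so \<open>J\<close> is at least
    \<open>m\<close> there; the parallelogram law expresses the squared distance as twice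
    \<open>J x + J y\<close> minus four times the value at the midpoint.\<close>
  have par: "(norm (x - y))\<^sup>2 \<le> 2 * (J x - m) + 2 * (J y - m)" if "x \<in> S" "y \<in> S" for x y
  proof -
    have "(1/2) *\<^sub>R (x + y) \<in> S" using S that by (simp add: subspace_add subspace_scale)
    from m_le[OF this] show ?thesis
      by (simp add: J_def power2_norm_eq_inner f.add f.scaleR inner_simps inner_commute algebra_simps)
  qed
  have "Cauchy X"
  proof (rule CauchyI)
    fix e :: real assume "0 < e"
    then obtain N where N: "inverse (real (Suc N)) < e\<^sup>2 / 4"
      using reals_Archimedean[of "e\<^sup>2 / 4"] by auto
    have near: "J (X k) < m + e\<^sup>2 / 4" if "N \<le> k" for k
    proof -
      have "J (X k) < m + inverse (real (Suc k))" by (rule X)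
      also have "\<dots> \<le> m + inverse (real (Suc N))" using that by (simp add: field_simps)
      also have "\<dots> < m + e\<^sup>2 / 4" using N by simp
      finally show ?thesis .
    qed
    have "norm (X i - X j) < e" if "N \<le> i" "N \<le> j" for i j
    proof -
      have "(norm (X i - X j))\<^sup>2 < e\<^sup>2"
        using par[OF X(1) X(1), of i j] near[OF that(1)] near[OF that(2)] by argo
      then show ?thesis using \<open>0 < e\<close> by (simp add: power_less_imp_less_base)
    qed
    then show "\<exists>M. \<forall>i\<ge>M. \<forall>j\<ge>M. norm (X i - X j) < e" by blast
  qed
  then obtain v where v: "X \<longlonglongrightarrow> v" using Cauchy_convergent convergent_def by blast
  have vS: "v \<in> S" using S(2) X(1) v closed_sequentially by blast
  have "(\<lambda>n. J (X n)) \<longlonglongrightarrow> J v"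
    unfolding J_def by (intro tendsto_intros f.tendsto v)
  moreover have "(\<lambda>n. m + inverse (real (Suc n))) \<longlonglongrightarrow> m + 0"
    by (intro tendsto_intros LIMSEQ_inverse_real_of_nat)
  ultimately have "J v \<le> m"
    using X(2) by (intro LIMSEQ_le[where X="\<lambda>n. J (X n)"]) (auto intro: less_imp_le)
  have "f s = inner s v" if "s \<in> S" for s
  proof -
    define a where "a = f s - inner s v"
    \<comment> \<open>First-order condition at the minimiser \<open>v\<close>: this is
      \<open>J v\<close> \<le> \<open>J (v + t *\<^sub>R s)\<close>, expanded.\<close>
    have *: "2 * t * a \<le> t\<^sup>2 * inner s s" for t
    proof -
      have "v + t *\<^sub>R s \<in> S" using S that vS by (simp add: subspace_add subspace_scale)
      then have "J v \<le> J (v + t *\<^sub>R s)" using m_le \<open>J v \<le> m\<close> by force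
      then show ?thesis
        by (simp add: J_def a_def f.add f.scaleR inner_simps inner_commute power2_eq_square algebra_simps)
    qed
    \<comment> \<open>The quadratic inequality is tested at \<open>t = a / q\<close>; the summand 1
      keeps \<open>q\<close> positive even for \<open>s = 0\<close> and leaves a strict surplus that
      forces \<open>a = 0\<close>.\<close>
    define q where "q = inner s s + 1"
    have "q > 0" unfolding q_def using inner_ge_zero[of s] by linarith
    have "2 * (a / q) * a * q\<^sup>2 \<le> (a / q)\<^sup>2 * inner s s * q\<^sup>2"
      using *[of "a / q"] by (intro mult_right_mono) auto
    then have "2 * a\<^sup>2 * q \<le> a\<^sup>2 * inner s s"
      using \<open>q > 0\<close> by (simp add: power2_eq_square field_simps)
    then have "a\<^sup>2 * (q + 1) \<le> 0" by (simp add: q_def algebra_simps)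
    then have "a = 0" using \<open>q > 0\<close> by (simp add: mult_le_0_iff)
    then show ?thesis by (simp add: a_def)
  qed
  with vS show ?thesis by blast
qed

lemma subspace_closure:
  fixes S :: "'a::real_normed_vector set"
  assumes "subspace S"
  shows "subspace (closure S)"
  unfolding subspace_def
proof (intro conjI allI ballI)
  show "0 \<in> closure S"
    using subspace_0[OF assms] closure_subset by blast
next
  fix x y assume "x \<in> closure S" "y \<in> closure S"
  then obtain X Y where "\<And>n. X n \<in> S" "X \<longlonglongrightarrow> x" "\<And>n. Y n \<in> S" "Y \<longlonglongrightarrow> y"
    unfolding closure_sequential by blast
  then have "(\<forall>n. X n + Y n \<in> S) \<and> (\<lambda>n. X n + Y n) \<longlonglongrightarrow> x + y"
    using subspace_add[OF assms] by (simp add: tendsto_add)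
  then show "x + y \<in> closure S"
    unfolding closure_sequential by (rule exI[where x="\<lambda>n. X n + Y n"])
next
  fix c x assume "x \<in> closure S"
  then obtain X where "\<And>n. X n \<in> S" "X \<longlonglongrightarrow> x"
    unfolding closure_sequential by blast
  then have "(\<forall>n. c *\<^sub>R X n \<in> S) \<and> (\<lambda>n. c *\<^sub>R X n) \<longlonglongrightarrow> c *\<^sub>R x"
    using subspace_scale[OF assms] by (simp add: tendsto_scaleR)
  then show "c *\<^sub>R x \<in> closure S"
    unfolding closure_sequential by (rule exI[where x="\<lambda>n. c *\<^sub>R X n"])
qed

text \<open>The functional given by \<open>x\<close> is represented on \<open>S\<close> by some
  \<open>v\<close> in \<open>S\<close>, and then \<open>x - v\<close> is orthogonal to
  \<open>S\<close>. The lemma yields both surjectivity and density later on.\<close>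

lemma closed_subspace_eq_UNIV:
  fixes S :: "'a::{real_inner, complete_space} set"
  assumes S: "subspace S" "closed S" and orth: "\<And>y. (\<And>s. s \<in> S \<Longrightarrow> inner s y = 0) \<Longrightarrow> y = 0"
  shows "S = UNIV"
proof -
  have "x \<in> S" for x
  proof -
    obtain v where v: "v \<in> S" "\<And>s. s \<in> S \<Longrightarrow> inner s x = inner s v"
      using riesz_on_subspace[OF S, of "\<lambda>s. inner s x"] by (auto intro: bounded_linear_inner_left)
    have "x - v = 0" by (rule orth) (simp add: inner_diff_right v(2))
    with v show ?thesis by simp
  qed
  then show ?thesis by blast
qed


section \<open>Bounded operators as graphs of functions\<close>

definition bounded_clinear :: "('a::chilbert_space \<Rightarrow> 'b::chilbert_space) \<Rightarrow> bool"
  where "bounded_clinear f \<longleftrightarrow> bounded_linear f \<and> (\<forall>c x. f (c *\<^sub>C x) = c *\<^sub>C f x)"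

definition op_graph :: "('a::chilbert_space \<Rightarrow> 'b::chilbert_space) \<Rightarrow> ('a, 'b) lop"
  where "op_graph f = {(x, y). y = f x}"

definition is_adjoint :: "('a::chilbert_space \<Rightarrow> 'b::chilbert_space) \<Rightarrow> ('b \<Rightarrow> 'a) \<Rightarrow> bool"
  where "is_adjoint f f' \<longleftrightarrow> (\<forall>x y. cinner (f x) y = cinner x (f' y))"

lemma mem_op_graph [simp]: "(x, y) \<in> op_graph f \<longleftrightarrow> y = f x"
  by (simp add: op_graph_def)

lemma mem_plus_graph [simp]: "(x, y) \<in> T +\<^sub>o op_graph k \<longleftrightarrow> (x, y - k x) \<in> T"
  by (force simp: op_plus_def op_graph_def)

lemma op_comp_graph: "op_graph f \<circ>\<^sub>o op_graph k = op_graph (\<lambda>x. f (k x))"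
  by (auto simp: op_graph_def)

lemma op_minus_graph: "op_graph f -\<^sub>o op_graph k = op_graph (\<lambda>x. f x - k x)"
  by (auto simp: op_graph_def op_minus_def)

lemma op_scale_graph: "c *\<^sub>o op_graph f = op_graph (\<lambda>x. c *\<^sub>C f x)"
  by (auto simp: op_graph_def op_scale_def)

lemma Id_eq_graph: "Id = op_graph (\<lambda>x. x)"
  by (auto simp: op_graph_def)

lemma bounded_clinearI:
  assumes "\<And>x y. f (x + y) = f x + f y" "\<And>c x. f (c *\<^sub>C x) = c *\<^sub>C f x"
    and "\<And>x. norm (f x) \<le> C * norm x"
  shows "bounded_clinear f"
  using assms unfolding bounded_clinear_def
  by (auto intro!: bounded_linear_intro[where K=C] simp: scaleR_eq_scaleC mult.commute)

lemma
  assumes "bounded_clinear f"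
  shows bounded_clinear_add: "f (x + y) = f x + f y"
    and bounded_clinear_diff: "f (x - y) = f x - f y"
    and bounded_clinear_minus: "f (- x) = - f x"
    and bounded_clinear_zero: "f 0 = 0"
    and bounded_clinear_scaleC: "f (c *\<^sub>C x) = c *\<^sub>C f x"
    and bounded_clinear_imp_continuous_on: "continuous_on S f"
  using assms unfolding bounded_clinear_def
  by (auto simp: linear_add linear_diff linear_neg linear_0 bounded_linear.linear
      linear_continuous_on)

lemmas bounded_clinear_simps = bounded_clinear_add bounded_clinear_diff bounded_clinear_minus
  bounded_clinear_zero bounded_clinear_scaleC

lemma bounded_clinear_bound:
  assumes "bounded_clinear f"
  obtains C where "0 \<le> C" "\<And>x. norm (f x) \<le> C * norm x"
  using assms bounded_linear.nonneg_bounded[of f]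
  by (auto simp: bounded_clinear_def mult.commute)

lemma bounded_clinear_scale [intro]:
  assumes f: "bounded_clinear f"
  shows "bounded_clinear (\<lambda>x. c *\<^sub>C f x)"
proof -
  obtain C where C: "0 \<le> C" "\<And>x. norm (f x) \<le> C * norm x"
    using bounded_clinear_bound[OF f] by blast
  show ?thesis
  proof (rule bounded_clinearI[where C="norm c * C"])
    show "norm (c *\<^sub>C f x) \<le> norm c * C * norm x" for x
      using C(2)[of x] by (simp add: norm_scaleC mult.assoc mult_left_mono)
  qed (use f in \<open>auto simp: bounded_clinear_simps scaleC_add_right mult.commute\<close>)
qed

lemma bounded_clinear_ident [intro]: "bounded_clinear (\<lambda>x. x)"
  by (rule bounded_clinearI[where C=1]) auto

lemma bounded_clinear_compose [intro]:
  "bounded_clinear f \<Longrightarrow> bounded_clinear g \<Longrightarrow> bounded_clinear (\<lambda>x. f (g x))"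
  unfolding bounded_clinear_def by (auto intro: bounded_linear_compose)

lemma bounded_clinear_plus [intro]:
  "bounded_clinear f \<Longrightarrow> bounded_clinear g \<Longrightarrow> bounded_clinear (\<lambda>x. f x + g x)"
  unfolding bounded_clinear_def by (auto intro: bounded_linear_add simp: scaleC_add_right)

lemma bounded_clinear_sub [intro]:
  "bounded_clinear f \<Longrightarrow> bounded_clinear g \<Longrightarrow> bounded_clinear (\<lambda>x. f x - g x)"
  unfolding bounded_clinear_def
  by (auto intro: bounded_linear_sub simp: cvec.scale_right_diff_distrib)

section \<open>Calculus of unbounded linear operators\<close>

lemma
  assumes "linear_op T"
  shows linear_op_single_valued: "(x, y) \<in> T \<Longrightarrow> (x, y') \<in> T \<Longrightarrow> y = y'"
    and linear_op_zero: "(0, 0) \<in> T"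
    and linear_op_add: "(x, y) \<in> T \<Longrightarrow> (x', y') \<in> T \<Longrightarrow> (x + x', y + y') \<in> T"
    and linear_op_scaleC: "(x, y) \<in> T \<Longrightarrow> (c *\<^sub>C x, c *\<^sub>C y) \<in> T"
  using assms unfolding linear_op_def by (auto dest: single_valuedD)

lemma linear_op_minus: "linear_op T \<Longrightarrow> (x, y) \<in> T \<Longrightarrow> (- x, - y) \<in> T"
  by (metis linear_op_scaleC scaleC_minus_one)

lemma linear_op_diff:
  "linear_op T \<Longrightarrow> (x, y) \<in> T \<Longrightarrow> (x', y') \<in> T \<Longrightarrow> (x - x', y - y') \<in> T"
  by (metis linear_op_add linear_op_minus diff_conv_add_uminus)

lemma linear_op_scaleR: "linear_op T \<Longrightarrow> (x, y) \<in> T \<Longrightarrow> (c *\<^sub>R x, c *\<^sub>R y) \<in> T"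
  unfolding scaleR_eq_scaleC by (rule linear_op_scaleC)

lemma linear_opI:
  assumes "\<And>x y y'. (x, y) \<in> T \<Longrightarrow> (x, y') \<in> T \<Longrightarrow> y = y'" "(0, 0) \<in> T"
    and "\<And>x y x' y'. (x, y) \<in> T \<Longrightarrow> (x', y') \<in> T \<Longrightarrow> (x + x', y + y') \<in> T"
    and "\<And>c x y. (x, y) \<in> T \<Longrightarrow> (c *\<^sub>C x, c *\<^sub>C y) \<in> T"
  shows "linear_op T"
  using assms unfolding linear_op_def single_valued_def by blast

lemma mem_op_plusI: "(x, y) \<in> S \<Longrightarrow> (x, y') \<in> T \<Longrightarrow> w = y + y' \<Longrightarrow> (x, w) \<in> S +\<^sub>o T"
  unfolding op_plus_def by blast

lemma mem_op_plusE:
  assumes "(x, w) \<in> S +\<^sub>o T"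
  obtains y y' where "(x, y) \<in> S" "(x, y') \<in> T" "w = y + y'"
  using assms unfolding op_plus_def by blast

lemma linear_op_plus:
  assumes "linear_op S" "linear_op T"
  shows "linear_op (S +\<^sub>o T)"
proof (rule linear_opI)
  show "(0, 0) \<in> S +\<^sub>o T"
    using assms[THEN linear_op_zero] by (rule mem_op_plusI) simp
  show "y = y'" if "(x, y) \<in> S +\<^sub>o T" "(x, y') \<in> S +\<^sub>o T" for x y y'
    using that by (elim mem_op_plusE) (auto dest: assms[THEN linear_op_single_valued])
  show "(x + x', y + y') \<in> S +\<^sub>o T" if "(x, y) \<in> S +\<^sub>o T" "(x', y') \<in> S +\<^sub>o T" for x y x' y'
    using that by (elim mem_op_plusE)
      (rule mem_op_plusI[OF assms[THEN linear_op_add]], assumption+, simp)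
  show "(c *\<^sub>C x, c *\<^sub>C y) \<in> S +\<^sub>o T" if "(x, y) \<in> S +\<^sub>o T" for c x y
    using that by (elim mem_op_plusE)
      (rule mem_op_plusI[OF assms[THEN linear_op_scaleC]], assumption+, simp add: scaleC_add_right)
qed

lemma linear_op_comp:
  assumes "linear_op S" "linear_op T"
  shows "linear_op (S \<circ>\<^sub>o T)"
proof (rule linear_opI)
  show "(0, 0) \<in> S \<circ>\<^sub>o T" using assms[THEN linear_op_zero] by blast
  show "y = y'" if "(x, y) \<in> S \<circ>\<^sub>o T" "(x, y') \<in> S \<circ>\<^sub>o T" for x y y'
    using that by (blast dest: assms[THEN linear_op_single_valued])
  show "(x + x', y + y') \<in> S \<circ>\<^sub>o T" if "(x, y) \<in> S \<circ>\<^sub>o T" "(x', y') \<in> S \<circ>\<^sub>o T" for x y x' y'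
    using that by (elim relcompEpair) (rule relcompI[OF linear_op_add[OF assms(2)] linear_op_add[OF assms(1)]])
  show "(c *\<^sub>C x, c *\<^sub>C y) \<in> S \<circ>\<^sub>o T" if "(x, y) \<in> S \<circ>\<^sub>o T" for c x y
    using that by (elim relcompEpair) (rule relcompI[OF assms(2,1)[THEN linear_op_scaleC]])
qed

lemma linear_op_converse:
  assumes "linear_op T" and "\<And>x. (x, 0) \<in> T \<Longrightarrow> x = 0"
  shows "linear_op (T\<inverse>)"
proof -
  have "x = x'" if "(x, y) \<in> T" "(x', y) \<in> T" for x x' y
    using linear_op_diff[OF assms(1) that] assms(2)[of "x - x'"] by simp
  then show ?thesis
    using assms(1) unfolding linear_op_def single_valued_def by auto
qed

lemma op_boundedI: "(\<And>x y. (x, y) \<in> T \<Longrightarrow> norm y \<le> C * norm x) \<Longrightarrow> op_bounded T"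
  unfolding op_bounded_def by blast

lemma op_boundedE:
  assumes "op_bounded T"
  obtains C where "\<And>x y. (x, y) \<in> T \<Longrightarrow> norm y \<le> C * norm x"
  using assms unfolding op_bounded_def by blast

lemma linear_op_graph: "bounded_clinear f \<Longrightarrow> linear_op (op_graph f)"
  by (rule linear_opI) (auto simp: bounded_clinear_simps)

lemma bounded_everywhere_op_graph:
  assumes "bounded_clinear f"
  shows "bounded_everywhere (op_graph f)"
proof -
  obtain C where "\<And>x. norm (f x) \<le> C * norm x" using bounded_clinear_bound[OF assms] by blast
  then have "op_bounded (op_graph f)" by (intro op_boundedI) auto
  moreover have "Domain (op_graph f) = UNIV" by (auto simp: op_graph_def)
  ultimately show ?thesis by (simp add: bounded_everywhere_def linear_op_graph assms)
qed

text \<open>The passage from relations to functions: inverses and resolvents become functions, on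
  which relational composition is plain composition.\<close>

lemma bounded_everywhereE:
  assumes "bounded_everywhere T"
  obtains f where "bounded_clinear f" "T = op_graph f"
proof -
  have T: "linear_op T" "Domain T = UNIV" using assms by (auto simp: bounded_everywhere_def)
  obtain C where C: "\<And>x y. (x, y) \<in> T \<Longrightarrow> norm y \<le> C * norm x"
    using assms op_boundedE unfolding bounded_everywhere_def by blast
  have "\<forall>x. \<exists>y. (x, y) \<in> T" using T(2) by auto
  then obtain f where f: "\<And>x. (x, f x) \<in> T" by metis
  have eq: "(x, y) \<in> T \<longleftrightarrow> y = f x" for x y
    using f linear_op_single_valued[OF T(1)] by blast
  have "bounded_clinear f"
  proof (rule bounded_clinearI[where C=C])
    show "f (x + y) = f x + f y" for x y
      using linear_op_add[OF T(1) f[of x] f[of y]] by (simp add: eq)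
    show "f (c *\<^sub>C x) = c *\<^sub>C f x" for c x
      using linear_op_scaleC[OF T(1) f[of x]] by (simp add: eq)
    show "norm (f x) \<le> C * norm x" for x using C f by blast
  qed
  moreover have "T = op_graph f" using eq by (auto simp: op_graph_def)
  ultimately show ?thesis using that by blast
qed

section \<open>Closedness under bounded perturbation\<close>

text \<open>The graph of the sum is the preimage of \<open>T\<close> under the continuous shear that
  subtracts \<open>k x\<close> from the second component.\<close>

lemma closed_plus_graph:
  assumes "closed T" "bounded_clinear k"
  shows "closed (T +\<^sub>o op_graph k)"
proof -
  have "T +\<^sub>o op_graph k = (\<lambda>q. (fst q, snd q - k (fst q))) -` T" by auto
  then show ?thesis
    by (simp only:) (intro closed_vimage assms continuous_intros
        continuous_on_compose2[OF bounded_clinear_imp_continuous_on[OF assms(2), of UNIV]]; simp)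
qed

text \<open>\<open>S\<close> may be defined on a proper subspace only, as B is. Along a convergent
  sequence of pairs the values of \<open>S\<close> are Cauchy, so those of \<open>T\<close> converge
  too; closedness of \<open>T\<close> then puts the limit into the domain of both.\<close>

lemma closed_bounded_plus:
  assumes S: "linear_op S" "op_bounded S" and T: "closed T" and dom: "Domain T \<subseteq> Domain S"
  shows "closed (S +\<^sub>o T)"
  unfolding closed_sequential_limits
proof (intro allI impI, elim conjE)
  fix q l assume q: "\<forall>n. q n \<in> S +\<^sub>o T" and lim: "q \<longlonglongrightarrow> l"
  obtain C where C: "\<And>x y. (x, y) \<in> S \<Longrightarrow> norm y \<le> C * norm x"
    using op_boundedE[OF S(2)] by blast
  have "\<forall>n. \<exists>x s t. q n = (x, s + t) \<and> (x, s) \<in> S \<and> (x, t) \<in> T"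
    using q by (auto simp: op_plus_def)
  then obtain x s t where xst: "\<And>n. q n = (x n, s n + t n)" "\<And>n. (x n, s n) \<in> S" "\<And>n. (x n, t n) \<in> T"
    by metis
  obtain x0 w where l: "l = (x0, w)" by (cases l)
  have x: "x \<longlonglongrightarrow> x0" and w: "(\<lambda>n. s n + t n) \<longlonglongrightarrow> w"
    using tendsto_fst[OF lim] tendsto_snd[OF lim] by (simp_all add: xst l)
  \<comment> \<open>The absolute value is taken because \<open>op_bounded\<close> allows a negative
    constant.\<close>
  have bound: "norm (s n - y) \<le> \<bar>C\<bar> * norm (x n - x')" if "(x', y) \<in> S" for n x' y
    using C[OF linear_op_diff[OF S(1) xst(2)[of n] that]]
    by (rule order_trans) (auto intro: mult_right_mono)
  have "Cauchy s"
  proof (rule CauchyI)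
    fix e :: real assume "0 < e"
    \<comment> \<open>The summand 1 covers the case \<open>C = 0\<close>.\<close>
    then have "0 < e / (\<bar>C\<bar> + 1)" by (simp add: add_nonneg_pos)
    then obtain M where M: "\<And>m n. M \<le> m \<Longrightarrow> M \<le> n \<Longrightarrow> norm (x m - x n) < e / (\<bar>C\<bar> + 1)"
      using CauchyD[OF LIMSEQ_imp_Cauchy[OF x]] by blast
    have "norm (s m - s n) < e" if "M \<le> m" "M \<le> n" for m n
    proof -
      have "norm (s m - s n) \<le> \<bar>C\<bar> * norm (x m - x n)" by (rule bound) (rule xst)
      also have "\<dots> \<le> (\<bar>C\<bar> + 1) * norm (x m - x n)" by (simp add: mult_right_mono)
      also have "\<dots> < e" using M[OF that] by (simp add: field_simps add_pos_nonneg)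
      finally show ?thesis .
    qed
    then show "\<exists>M. \<forall>m\<ge>M. \<forall>n\<ge>M. norm (s m - s n) < e" by blast
  qed
  then obtain s0 where s: "s \<longlonglongrightarrow> s0" using Cauchy_convergent convergent_def by blast
  have "(\<lambda>n. (s n + t n) - s n) \<longlonglongrightarrow> w - s0" by (intro tendsto_diff w s)
  then have "(\<lambda>n. (x n, t n)) \<longlonglongrightarrow> (x0, w - s0)" by (intro tendsto_Pair x) simp
  then have t0: "(x0, w - s0) \<in> T" by (rule closed_sequentially[OF T xst(3)])
  then obtain y where y: "(x0, y) \<in> S" using dom by (meson Domain.simps subsetD)
  \<comment> \<open>Only now is \<open>S\<close> known to be defined at \<open>x0\<close>, so that
    boundedness can compare \<open>s n\<close> with the value \<open>y\<close> there.\<close>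
  have "(\<lambda>n. s n - y) \<longlonglongrightarrow> 0"
  proof (rule Lim_null_comparison)
    show "\<forall>\<^sub>F n in sequentially. norm (s n - y) \<le> \<bar>C\<bar> * norm (x n - x0)"
      using bound[OF y] by simp
    have "(\<lambda>n. \<bar>C\<bar> * norm (x n - x0)) \<longlonglongrightarrow> \<bar>C\<bar> * norm (x0 - x0)" by (intro tendsto_intros x)
    then show "(\<lambda>n. \<bar>C\<bar> * norm (x n - x0)) \<longlonglongrightarrow> 0" by simp
  qed
  then have "s \<longlonglongrightarrow> y" by (simp add: LIM_zero_iff)
  with s have "y = s0" using LIMSEQ_unique by blast
  with y t0 show "l \<in> S +\<^sub>o T" unfolding l op_plus_def by force
qed


section \<open>Adjoints\<close>

text \<open>The representation theorem for the real inner product gives \<open>f'\<close> pointwise;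
  rotation by -i upgrades the identity to the complex inner product. The norm bound comes from
  testing at \<open>f' y\<close>.\<close>

lemma ex_is_adjoint:
  assumes "bounded_clinear f"
  obtains f' where "bounded_clinear f'" "is_adjoint f f'"
proof -
  obtain C where C: "0 \<le> C" "\<And>x. norm (f x) \<le> C * norm x"
    using assms by (rule bounded_clinear_bound) blast
  have "\<exists>v. \<forall>x. inner (f x) y = inner x v" for y
  proof -
    have "bounded_linear (\<lambda>x. inner (f x) y)"
      using assms by (auto simp: bounded_clinear_def intro: bounded_linear_inner_left_comp)
    from riesz_on_subspace[OF _ _ this, of UNIV] show ?thesis by auto
  qed
  then obtain f' where f': "\<And>x y. inner (f x) y = inner x (f' y)" by metis
  have adj: "cinner (f x) y = cinner x (f' y)" for x y
    using f'[of x y] f'[of "(- \<i>) *\<^sub>C x" y]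
    by (simp only: complex_eq_iff Im_cinner bounded_clinear_scaleC[OF assms] inner_eq_Re_cinner)
  have "bounded_clinear f'"
  proof (rule bounded_clinearI[where C=C])
    show "f' (x + y) = f' x + f' y" for x y
      by (rule cinner_extensionality) (simp add: cinner_simps flip: adj)
    show "f' (c *\<^sub>C x) = c *\<^sub>C f' x" for c x
      by (rule cinner_extensionality) (simp add: cinner_simps flip: adj)
    show "norm (f' y) \<le> C * norm y" for y
    proof -
      have "norm (f' y) * norm (f' y) = inner (f (f' y)) y"
        by (simp add: f' flip: power2_norm_eq_inner power2_eq_square)
      also have "\<dots> \<le> norm (f (f' y)) * norm y" by (rule norm_cauchy_schwarz)
      also have "\<dots> \<le> (C * norm (f' y)) * norm y" by (intro mult_right_mono C) auto
      finally have "norm (f' y) * norm (f' y) \<le> norm (f' y) * (C * norm y)" by (simp add: mult_ac)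
      then show ?thesis
        using C(1) by (cases "norm (f' y) = 0") (auto simp: mult_le_cancel_left)
    qed
  qed
  with adj show ?thesis using that by (auto simp: is_adjoint_def)
qed

lemma is_adjointD: "is_adjoint f f' \<Longrightarrow> cinner (f x) y = cinner x (f' y)"
  by (simp add: is_adjoint_def)

lemma is_adjointD': "is_adjoint f f' \<Longrightarrow> cinner (f' x) y = cinner x (f y)"
  by (metis is_adjoint_def cinner_commute)

lemma adjoint_op_graph:
  assumes "is_adjoint f f'"
  shows "adjoint_op (op_graph f) = op_graph f'"
proof -
  have "(y, v) \<in> adjoint_op (op_graph f) \<longleftrightarrow> v = f' y" for y v
    using cinner_extensionality[of v "f' y"]
    by (auto simp: adjoint_op_def op_graph_def is_adjointD[OF assms])
  then show ?thesis by (auto simp: op_graph_def)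
qed

text \<open>Each pair in \<open>T\<close> imposes one closed condition on the pairs of the
  adjoint.\<close>

lemma closed_adjoint_op: "closed (adjoint_op T)"
proof -
  have "adjoint_op T = (\<Inter>(x, w)\<in>T. {q. cinner w (fst q) = cinner x (snd q)})"
    by (force simp: adjoint_op_def)
  then show ?thesis
    by (auto intro!: closed_INT closed_Collect_eq continuous_on_cinner_right continuous_intros)
qed

section \<open>Self-adjoint operators and definite perturbations\<close>

lemma
  assumes "selfadjoint_op T"
  shows selfadjoint_op_linear: "linear_op T"
    and selfadjoint_op_closed: "closed T"
    and selfadjoint_op_sym: "(x, y) \<in> T \<Longrightarrow> (x', y') \<in> T \<Longrightarrow> cinner y x' = cinner x y'"
    and selfadjoint_op_maximal: "(\<And>x y. (x, y) \<in> T \<Longrightarrow> cinner y u = cinner x v) \<Longrightarrow> (u, v) \<in> T"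
proof -
  have T: "adjoint_op T = T" "linear_op T" using assms by (auto simp: selfadjoint_op_def)
  show "linear_op T" by fact
  show "closed T" using closed_adjoint_op[of T] T by simp
  show "(x, y) \<in> T \<Longrightarrow> (x', y') \<in> T \<Longrightarrow> cinner y x' = cinner x y'"
    using T(1) unfolding adjoint_op_def by blast
  show "(\<And>x y. (x, y) \<in> T \<Longrightarrow> cinner y u = cinner x v) \<Longrightarrow> (u, v) \<in> T"
    using T(1) unfolding adjoint_op_def by blast
qed

lemma selfadjoint_op_real:
  assumes "selfadjoint_op T" "(x, y) \<in> T"
  shows "Im (cinner y x) = 0"
  using selfadjoint_op_sym[OF assms assms(2)] cinner_commute[of x y] by (simp add: complex_eq_iff)

text \<open>A numerical range argument. \<open>T\<close> contributes nothing to the imaginary part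
  of the quadratic form, so definiteness of \<open>k\<close> bounds the sum from below; this gives
  injectivity, closed range and a bounded inverse. Surjectivity follows because a vector orthogonal
  to the range lies in the domain, by self-adjointness, and is killed there by definiteness.\<close>

lemma selfadjoint_perturbation_invertible:
  assumes T: "selfadjoint_op T" and k: "bounded_clinear k" and "0 < c"
    and definite: "\<And>x. c * (norm x)\<^sup>2 \<le> \<bar>Im (cinner (k x) x)\<bar>"
  shows "bounded_everywhere ((T +\<^sub>o op_graph k)\<inverse>)"
proof -
  define N where "N = T +\<^sub>o op_graph k"
  have N: "linear_op N" "closed N"
    unfolding N_def using linear_op_plus[OF selfadjoint_op_linear[OF T] linear_op_graph[OF k]]
      closed_plus_graph[OF selfadjoint_op_closed[OF T] k] by auto
  have Im: "Im (cinner w x) = Im (cinner (k x) x)" if "(x, w) \<in> N" for x w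
    using that selfadjoint_op_real[OF T, of x "w - k x"] by (simp add: N_def cinner_simps)
  have lower: "c * norm x \<le> norm w" if "(x, w) \<in> N" for x w
  proof -
    have "norm x * (c * norm x) \<le> norm x * norm w"
      using definite[of x] abs_Im_cinner_le[of w x] Im[OF that]
      by (simp add: power2_eq_square mult_ac)
    then show ?thesis by (cases "norm x = 0") (auto simp: mult_le_cancel_left)
  qed
  have lin: "linear_op (N\<inverse>)"
    using lower[of _ 0] \<open>0 < c\<close> by (intro linear_op_converse N) (auto simp: mult_le_0_iff)
  have "Range N = UNIV"
  proof (rule closed_subspace_eq_UNIV)
    show "subspace (Range N)"
      unfolding subspace_def
      using linear_op_zero[OF N(1)] linear_op_add[OF N(1)] linear_op_scaleR[OF N(1)] by blast
    show "closed (Range N)"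
      unfolding closed_sequential_limits
    proof (intro allI impI, elim conjE)
      fix w l assume "\<forall>n. w n \<in> Range N" and w: "w \<longlonglongrightarrow> l"
      then have "\<forall>n. \<exists>x. (x, w n) \<in> N" by auto
      then obtain x where x: "\<And>n. (x n, w n) \<in> N" by metis
      have "Cauchy x"
      proof (rule CauchyI)
        fix e :: real assume "0 < e"
        then obtain M where M: "\<And>m n. M \<le> m \<Longrightarrow> M \<le> n \<Longrightarrow> norm (w m - w n) < c * e"
          using CauchyD[OF LIMSEQ_imp_Cauchy[OF w], of "c * e"] \<open>0 < c\<close> by force
        have "norm (x m - x n) < e" if "M \<le> m" "M \<le> n" for m n
          using lower[OF linear_op_diff[OF N(1) x[of m] x[of n]]] M[OF that] \<open>0 < c\<close>
          by (metis mult_less_cancel_left_pos order_le_less_trans)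
        then show "\<exists>M. \<forall>m\<ge>M. \<forall>n\<ge>M. norm (x m - x n) < e" by blast
      qed
      then obtain x0 where "x \<longlonglongrightarrow> x0" using Cauchy_convergent convergent_def by blast
      with w have "(\<lambda>n. (x n, w n)) \<longlonglongrightarrow> (x0, l)" by (intro tendsto_Pair)
      then have "(x0, l) \<in> N" by (rule closed_sequentially[OF N(2) x])
      then show "l \<in> Range N" by blast
    qed
    fix y assume y: "\<And>w. w \<in> Range N \<Longrightarrow> inner w y = 0"
    \<comment> \<open>Real orthogonality to the range extends to complex orthogonality, as the range
      is invariant under rotation by -i.\<close>
    have orth: "cinner w y = 0" if "(x, w) \<in> N" for x w
    proof -
      have "(- \<i>) *\<^sub>C w \<in> Range N" using linear_op_scaleC[OF N(1) that] by blast
      with that y show ?thesis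
        by (auto simp: complex_eq_iff Im_cinner simp flip: inner_eq_Re_cinner
            simp del: cvec.scale_minus_left)
    qed
    obtain k' where k': "is_adjoint k k'" using ex_is_adjoint[OF k] by blast
    \<comment> \<open>Orthogonality to all \<open>u + k x\<close> says that the adjoint of
      \<open>T\<close> maps \<open>y\<close> to \<open>- k' y\<close>.\<close>
    have "(y, - k' y) \<in> T"
    proof (rule selfadjoint_op_maximal[OF T])
      fix x u assume "(x, u) \<in> T"
      then have "cinner (u + k x) y = 0" by (intro orth[of x]) (simp add: N_def)
      then show "cinner u y = cinner x (- k' y)"
        by (simp add: cinner_simps is_adjointD[OF k'] eq_neg_iff_add_eq_0)
    qed
    then have yN: "(y, k y - k' y) \<in> N" by (simp add: N_def)
    have "Im (cinner (k y) y) = 0" using Im[OF yN] orth[OF yN] by simp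
    with definite[of y] \<open>0 < c\<close> show "y = 0" by (simp add: mult_le_0_iff)
  qed
  moreover have "op_bounded (N\<inverse>)"
    unfolding op_bounded_def using lower \<open>0 < c\<close>
    by (intro exI[of _ "inverse c"]) (auto simp: field_simps)
  ultimately show ?thesis using lin by (auto simp: bounded_everywhere_def N_def)
qed

section \<open>Resolvents\<close>

lemma mem_resolvent: "(h, u) \<in> resolvent T z \<longleftrightarrow> (u, h + z *\<^sub>C u) \<in> T"
  unfolding resolvent_def op_minus_def op_scale_def by force

text \<open>Sending (x, y) to (y - z x, x) is a bijection on pairs. This yields uniqueness of the
  realisation from a single spectral parameter.\<close>

lemma resolvent_inj: "resolvent S z = resolvent T z \<Longrightarrow> S = T"
proof -
  assume eq: "resolvent S z = resolvent T z"
  have "(x, y) \<in> S \<longleftrightarrow> (x, y) \<in> T" for x y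
    using mem_resolvent[of "y - z *\<^sub>C x" x S z] mem_resolvent[of "y - z *\<^sub>C x" x T z] eq by simp
  then show "S = T" by auto
qed

lemma nonreal_in_resolvent_set:
  assumes "selfadjoint_op T" "Im z \<noteq> 0"
  shows "z \<in> resolvent_set T"
proof -
  have "bounded_everywhere ((T +\<^sub>o op_graph (\<lambda>x. (- z) *\<^sub>C x))\<inverse>)"
    using assms
    by (intro selfadjoint_perturbation_invertible[where c="\<bar>Im z\<bar>"] bounded_clinear_scale
        bounded_clinear_ident)
      (auto simp: cinner_simps cinner_self abs_mult simp del: of_real_power)
  moreover have "(T +\<^sub>o op_graph (\<lambda>x. (- z) *\<^sub>C x))\<inverse> = resolvent T z"
    by (auto simp: mem_resolvent)
  ultimately show ?thesis by (simp add: resolvent_set_def)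
qed


section \<open>Realisations with bounded boundary parameter\<close>

text \<open>\<open>R\<close>, \<open>p\<close> and \<open>p'\<close> are the inverse of
  \<open>A\<^sub>0\<close>, the operator Pi and its adjoint, as functions. The assumption
  \<open>direct\<close> combines injectivity of \<open>R\<close> and of \<open>p\<close> with the
  trivial intersection of their ranges, and makes the coordinates of \<open>R f + p \<phi>\<close>
  unique.\<close>

locale boundary_setup =
  fixes A\<^sub>0 :: "('h::chilbert_space, 'h) lop" and P :: "('e::chilbert_space, 'h) lop"
    and R :: "'h \<Rightarrow> 'h" and p :: "'e \<Rightarrow> 'h" and p' :: "'h \<Rightarrow> 'e"
  assumes A0_inv: "A\<^sub>0\<inverse> = op_graph R" and P_eq: "P = op_graph p"
    and R: "bounded_clinear R" and p: "bounded_clinear p" and p': "bounded_clinear p'"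
    and adj_R: "is_adjoint R R" and adj_p: "is_adjoint p p'"
    and direct: "R f + p \<phi> = 0 \<Longrightarrow> f = 0 \<and> \<phi> = 0"
begin

lemmas fun_simps = bounded_clinear_simps[OF R] bounded_clinear_simps[OF p] bounded_clinear_simps[OF p']
  scaleC_add_right cvec.scale_right_diff_distrib

lemma mem_A0: "(u, f) \<in> A\<^sub>0 \<longleftrightarrow> u = R f"
  using A0_inv by (metis converse_iff mem_op_graph)

lemma direct_eq:
  assumes "R f + p \<phi> = R f' + p \<phi>'"
  shows "f = f'" "\<phi> = \<phi>'"
proof -
  have "R (f - f') + p (\<phi> - \<phi>') = 0" using assms by (simp add: fun_simps algebra_simps)
  from direct[OF this] show "f = f'" "\<phi> = \<phi>'" by simp_all
qed

section \<open>The inverse of I - z R and the M-function\<close>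

definition is_res :: "complex \<Rightarrow> ('h \<Rightarrow> 'h) \<Rightarrow> bool"
  where "is_res z g \<longleftrightarrow> bounded_clinear g \<and>
    (\<forall>h. g h - z *\<^sub>C R (g h) = h) \<and> (\<forall>f. g (f - z *\<^sub>C R f) = f)"

lemma
  assumes "is_res z g"
  shows is_res_bounded: "bounded_clinear g"
    and is_res_right: "g h - z *\<^sub>C R (g h) = h"
    and is_res_left: "g (f - z *\<^sub>C R f) = f"
    and is_res_scaleC_R: "z *\<^sub>C R (g h) = g h - h"
  using assms unfolding is_res_def by (auto simp: algebra_simps)

lemma is_res_eqI: "is_res z g \<Longrightarrow> f - z *\<^sub>C R f = h \<Longrightarrow> f = g h"
  by (metis is_res_left)

text \<open>With \<open>r\<close> the resolvent of \<open>A\<^sub>0\<close> at \<open>z\<close>, the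
  inverse of I - z R is I + z r.\<close>

lemma ex_is_res:
  assumes "z \<in> resolvent_set A\<^sub>0"
  obtains g where "is_res z g"
proof -
  have "bounded_everywhere (resolvent A\<^sub>0 z)" using assms by (simp add: resolvent_set_def)
  then obtain r where r: "bounded_clinear r" "resolvent A\<^sub>0 z = op_graph r"
    by (rule bounded_everywhereE)
  have eq: "u = r h \<longleftrightarrow> u = R (h + z *\<^sub>C u)" for h u
    using mem_resolvent[of h u A\<^sub>0 z] by (simp add: r(2) mem_A0)
  have "is_res z (\<lambda>h. h + z *\<^sub>C r h)"
    unfolding is_res_def
  proof (intro conjI allI)
    show "bounded_clinear (\<lambda>h. h + z *\<^sub>C r h)"
      by (intro bounded_clinear_plus bounded_clinear_ident bounded_clinear_scale r)
    show "h + z *\<^sub>C r h - z *\<^sub>C R (h + z *\<^sub>C r h) = h" for h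
      using eq[of "r h" h] by simp
    show "f - z *\<^sub>C R f + z *\<^sub>C r (f - z *\<^sub>C R f) = f" for f
      using eq[of "R f" "f - z *\<^sub>C R f"] by simp
  qed
  then show ?thesis by (rule that)
qed

text \<open>Since \<open>R\<close> is symmetric, I - z R and I - cnj z R are mutually adjoint, hence
  so are their inverses.\<close>

lemma is_res_adjoint:
  assumes "is_res z g" "is_res (cnj z) g'"
  shows "is_adjoint g g'"
  unfolding is_adjoint_def
proof (intro allI)
  fix x y
  have "cinner (g x) (g' y - cnj z *\<^sub>C R (g' y)) = cinner (g x - z *\<^sub>C R (g x)) (g' y)"
    by (simp add: cinner_simps is_adjointD[OF adj_R])
  then show "cinner (g x) y = cinner x (g' y)"
    by (simp add: is_res_right[OF assms(1)] is_res_right[OF assms(2)])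
qed

context
  fixes z g assumes g: "is_res z g"
begin

lemma g_simps: "g (x + y) = g x + g y" "g (x - y) = g x - g y" "g (- x) = - g x" "g 0 = 0"
  "g (c *\<^sub>C x) = c *\<^sub>C g x"
  using is_res_bounded[OF g] by (simp_all add: bounded_clinear_simps)

lemma resolvent_A0: "resolvent A\<^sub>0 z = op_graph (\<lambda>h. R (g h))"
proof -
  have "u = R (h + z *\<^sub>C u) \<longleftrightarrow> u = R (g h)" for h u
  proof
    assume u: "u = R (h + z *\<^sub>C u)"
    then have "h + z *\<^sub>C u = g h" by (intro is_res_eqI[OF g]) simp
    with u show "u = R (g h)" by simp
  qed (simp add: is_res_scaleC_R[OF g])
  then show ?thesis by (auto simp: mem_resolvent mem_A0 op_graph_def)
qed

lemma Id_minus_inverse: "(Id -\<^sub>o z *\<^sub>o A\<^sub>0\<inverse>)\<inverse> = op_graph g"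
proof -
  have "(h, f) \<in> (Id -\<^sub>o z *\<^sub>o A\<^sub>0\<inverse>)\<inverse> \<longleftrightarrow> h = f - z *\<^sub>C R f" for h f
    unfolding A0_inv op_minus_def op_scale_def op_graph_def by auto
  then have "(h, f) \<in> (Id -\<^sub>o z *\<^sub>o A\<^sub>0\<inverse>)\<inverse> \<longleftrightarrow> f = g h" for h f
    using is_res_left[OF g, of f] is_res_right[OF g, of h] by auto
  then show ?thesis by (auto simp: op_graph_def)
qed

lemma M_fun_eq: "M_fun A\<^sub>0 P \<Lambda> z = \<Lambda> +\<^sub>o op_graph (\<lambda>\<phi>. z *\<^sub>C p' (g (p \<phi>)))"
proof -
  have "(g (p \<phi>), w) \<in> Gamma1 A\<^sub>0 P \<Lambda> \<longleftrightarrow> (\<phi>, w - z *\<^sub>C p' (g (p \<phi>))) \<in> \<Lambda>" for \<phi> w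
  proof -
    \<comment> \<open>The values of the gamma field in coordinates; \<open>Gamma1\<close> can then
      be read off by uniqueness of the decomposition.\<close>
    have dec: "g (p \<phi>) = R (z *\<^sub>C g (p \<phi>)) + p \<phi>"
      by (simp add: fun_simps is_res_scaleC_R[OF g])
    have "(g (p \<phi>), w) \<in> Gamma1 A\<^sub>0 P \<Lambda> \<longleftrightarrow>
        (\<exists>f \<psi> l. g (p \<phi>) = R f + p \<psi> \<and> w = p' f + l \<and> (\<psi>, l) \<in> \<Lambda>)"
      unfolding Gamma1_def A0_inv P_eq adjoint_op_graph[OF adj_p] by auto
    also have "\<dots> \<longleftrightarrow> (\<exists>l. w = p' (z *\<^sub>C g (p \<phi>)) + l \<and> (\<phi>, l) \<in> \<Lambda>)"
      using dec direct_eq by metis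
    also have "\<dots> \<longleftrightarrow> (\<phi>, w - z *\<^sub>C p' (g (p \<phi>))) \<in> \<Lambda>"
      by (force simp: fun_simps)
    finally show ?thesis .
  qed
  then show ?thesis
    unfolding M_fun_def gamma_field_def Id_minus_inverse P_eq by force
qed

end

section \<open>Boundary extensions and their resolvents\<close>

text \<open>The operator with boundary condition \<open>C \<Gamma>\<^sub>0 u + \<Pi>\<^sup>* A u = 0\<close>; the realisation
  belongs to \<open>C = B + \<Lambda>\<close>.\<close>

definition ext :: "('e, 'e) lop \<Rightarrow> ('h, 'h) lop"
  where "ext C = {(R f + p \<phi>, f) | f \<phi>. (\<phi>, - p' f) \<in> C}"

lemma mem_ext: "(u, f) \<in> ext C \<longleftrightarrow> (\<exists>\<phi>. u = R f + p \<phi> \<and> (\<phi>, - p' f) \<in> C)"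
  unfolding ext_def by blast

lemma extE:
  assumes "(u, f) \<in> ext C"
  obtains \<phi> where "u = R f + p \<phi>" "(\<phi>, - p' f) \<in> C"
  using assms unfolding ext_def by blast

text \<open>For C = B + Lambda the inverted operator is B + M(z), so \<open>n\<close> is minus the
  value of \<open>Q_fun\<close>.\<close>

context
  fixes z g C n
  assumes g: "is_res z g" and n: "bounded_clinear n"
    and inv: "(C +\<^sub>o op_graph (\<lambda>\<phi>. z *\<^sub>C p' (g (p \<phi>))))\<inverse> = op_graph n"
begin

lemma mem_inv: "(\<phi>, w - z *\<^sub>C p' (g (p \<phi>))) \<in> C \<longleftrightarrow> \<phi> = n w"
  using inv by (metis converse_iff mem_op_graph mem_plus_graph)

text \<open>Two forms of the same vector: the first displays the coordinates, from which
  \<open>Gamma0\<close> is read off, and the second is Krein's formula.\<close>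

lemma resolvent_ext_iff:
  "(h, u) \<in> resolvent (ext C) z \<longleftrightarrow> u = R (h + z *\<^sub>C u) + p (- n (p' (g h)))"
  "(h, u) \<in> resolvent (ext C) z \<longleftrightarrow> u = R (g h) - g (p (n (p' (g h))))"
proof -
  \<comment> \<open>For fixed \<open>\<phi>\<close> the implicit equation is solved for
    \<open>u\<close>: the vector f = h + z u satisfies f - z R f = h + z p \<phi>, hence f = g (h +
    z p \<phi>).\<close>
  have key: "u = R (h + z *\<^sub>C u) + p \<phi> \<longleftrightarrow> u = R (g h) + g (p \<phi>)"
    and f: "u = R (g h) + g (p \<phi>) \<Longrightarrow> h + z *\<^sub>C u = g h + z *\<^sub>C g (p \<phi>)" for \<phi>
  proof -
    show f: "h + z *\<^sub>C u = g h + z *\<^sub>C g (p \<phi>)" if "u = R (g h) + g (p \<phi>)"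
      using that by (simp add: fun_simps is_res_scaleC_R[OF g])
    have Rf: "R (g h + z *\<^sub>C g (p \<phi>)) + p \<phi> = R (g h) + g (p \<phi>)"
      by (simp add: fun_simps is_res_scaleC_R[OF g])
    show "u = R (h + z *\<^sub>C u) + p \<phi> \<longleftrightarrow> u = R (g h) + g (p \<phi>)"
    proof
      assume u: "u = R (h + z *\<^sub>C u) + p \<phi>"
      then have "z *\<^sub>C u = z *\<^sub>C R (h + z *\<^sub>C u) + z *\<^sub>C p \<phi>"
        by (metis scaleC_add_right)
      then have "h + z *\<^sub>C u = g (h + z *\<^sub>C p \<phi>)"
        by (intro is_res_eqI[OF g]) (simp add: algebra_simps)
      with u Rf show "u = R (g h) + g (p \<phi>)" by (simp add: g_simps[OF g])
    next
      assume u: "u = R (g h) + g (p \<phi>)"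
      have "R (h + z *\<^sub>C u) + p \<phi> = R (g h) + g (p \<phi>)" by (simp only: f[OF u] Rf)
      with u show "u = R (h + z *\<^sub>C u) + p \<phi>" by simp
    qed
  qed
  have "(h, u) \<in> resolvent (ext C) z \<longleftrightarrow>
      (\<exists>\<phi>. u = R (g h) + g (p \<phi>) \<and> (\<phi>, - p' (g h + z *\<^sub>C g (p \<phi>))) \<in> C)"
    unfolding mem_resolvent mem_ext using key f by metis
  \<comment> \<open>The boundary condition now says that C + z p' g p maps \<open>\<phi>\<close> to
    \<open>- p' (g h)\<close>.\<close>
  also have "\<dots> \<longleftrightarrow> (\<exists>\<phi>. u = R (g h) + g (p \<phi>) \<and> \<phi> = - n (p' (g h)))"
    using mem_inv[of _ "- p' (g h)"] by (simp add: fun_simps bounded_clinear_simps[OF n])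
  finally have *: "(h, u) \<in> resolvent (ext C) z \<longleftrightarrow> u = R (g h) + g (p (- n (p' (g h))))" by simp
  then show "(h, u) \<in> resolvent (ext C) z \<longleftrightarrow> u = R (h + z *\<^sub>C u) + p (- n (p' (g h)))"
    by (simp only: key)
  from * show "(h, u) \<in> resolvent (ext C) z \<longleftrightarrow> u = R (g h) - g (p (n (p' (g h))))"
    by (simp add: fun_simps g_simps[OF g])
qed

lemma resolvent_ext: "resolvent (ext C) z = op_graph (\<lambda>h. R (g h) - g (p (n (p' (g h)))))"
  by (auto simp: resolvent_ext_iff(2) op_graph_def)

lemma bounded_clinear_resolvent_ext: "bounded_clinear (\<lambda>h. R (g h) - g (p (n (p' (g h)))))"
  by (intro bounded_clinear_sub bounded_clinear_compose[OF R] bounded_clinear_compose[OF p]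
      bounded_clinear_compose[OF p'] bounded_clinear_compose[OF n]
      bounded_clinear_compose[OF is_res_bounded[OF g]] is_res_bounded[OF g])

lemma resolvent_set_ext: "z \<in> resolvent_set (ext C)"
  by (simp add: resolvent_set_def resolvent_ext bounded_everywhere_op_graph
      bounded_clinear_resolvent_ext)

lemma Gamma0_resolvent_ext:
  "Gamma0 A\<^sub>0 P \<circ>\<^sub>o resolvent (ext C) z = op_graph (\<lambda>h. - n (p' (g h)))"
proof -
  have G: "(u, \<phi>) \<in> Gamma0 A\<^sub>0 P \<longleftrightarrow> (\<exists>f. u = R f + p \<phi>)" for u \<phi>
    unfolding Gamma0_def A0_inv P_eq by auto
  have "(h, \<phi>) \<in> Gamma0 A\<^sub>0 P \<circ>\<^sub>o resolvent (ext C) z \<longleftrightarrow> \<phi> = - n (p' (g h))" for h \<phi>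
  proof
    assume "(h, \<phi>) \<in> Gamma0 A\<^sub>0 P \<circ>\<^sub>o resolvent (ext C) z"
    then obtain u f where "(h, u) \<in> resolvent (ext C) z" "u = R f + p \<phi>"
      using G by blast
    then show "\<phi> = - n (p' (g h))"
      using resolvent_ext_iff(1)[of h u] direct_eq(2)[of f \<phi>] by metis
  next
    assume \<phi>: "\<phi> = - n (p' (g h))"
    define u where "u = R (g h) - g (p (n (p' (g h))))"
    then have u: "(h, u) \<in> resolvent (ext C) z" by (simp add: resolvent_ext)
    then have "(u, \<phi>) \<in> Gamma0 A\<^sub>0 P" using resolvent_ext_iff(1)[of h u] G \<phi> by blast
    with u show "(h, \<phi>) \<in> Gamma0 A\<^sub>0 P \<circ>\<^sub>o resolvent (ext C) z" by blast
  qed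
  then show ?thesis by (auto simp: op_graph_def)
qed

text \<open>The graph is the solution set of a continuous equation, u = r (f - z u) with the bounded
  resolvent r.\<close>

lemma closed_ext: "closed (ext C)"
proof -
  let ?r = "\<lambda>h. R (g h) - g (p (n (p' (g h))))"
  have "(u, f) \<in> ext C \<longleftrightarrow> u = ?r (f - z *\<^sub>C u)" for u f
    using mem_resolvent[of "f - z *\<^sub>C u" u "ext C" z] by (simp add: resolvent_ext)
  then have eq: "ext C = {q. fst q = ?r (snd q - z *\<^sub>C fst q)}" by auto
  have "continuous_on UNIV (\<lambda>q::'h \<times> 'h. z *\<^sub>C fst q)"
    by (rule continuous_on_compose2[OF bounded_clinear_imp_continuous_on[OF
          bounded_clinear_scale[OF bounded_clinear_ident], of UNIV]]) (auto intro: continuous_intros)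
  then have "continuous_on UNIV (\<lambda>q. ?r (snd q - z *\<^sub>C fst q))"
    by (intro continuous_on_compose2[OF bounded_clinear_imp_continuous_on[OF
          bounded_clinear_resolvent_ext, of UNIV]] continuous_intros) auto
  then show ?thesis
    unfolding eq by (intro closed_Collect_eq continuous_on_fst continuous_on_id)
qed

lemma linear_ext:
  assumes "linear_op C"
  shows "linear_op (ext C)"
proof (rule linear_opI)
  show "y = y'" if "(x, y) \<in> ext C" "(x, y') \<in> ext C" for x y y'
    using that direct_eq(1) unfolding mem_ext by blast
  show "(0, 0) \<in> ext C"
    using linear_op_zero[OF assms] by (auto simp: mem_ext fun_simps intro!: exI[of _ 0])
  show "(x + x', y + y') \<in> ext C" if xy: "(x, y) \<in> ext C" "(x', y') \<in> ext C" for x y x' y'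
  proof -
    obtain \<phi> \<psi> where "x = R y + p \<phi>" "(\<phi>, - p' y) \<in> C" "x' = R y' + p \<psi>" "(\<psi>, - p' y') \<in> C"
      using xy unfolding mem_ext by blast
    then show ?thesis
      using linear_op_add[OF assms, of \<phi> "- p' y" \<psi> "- p' y'"]
      by (auto simp: mem_ext fun_simps intro!: exI[of _ "\<phi> + \<psi>"])
  qed
  show "(c *\<^sub>C x, c *\<^sub>C y) \<in> ext C" if xy: "(x, y) \<in> ext C" for c x y
  proof -
    obtain \<phi> where "x = R y + p \<phi>" "(\<phi>, - p' y) \<in> C" using xy by (rule extE)
    then show ?thesis
      using linear_op_scaleC[OF assms, of \<phi> "- p' y" c]
      by (auto simp: mem_ext fun_simps intro!: exI[of _ "c *\<^sub>C \<phi>"])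
  qed
qed

text \<open>A vector \<open>y\<close> orthogonal to the range of the resolvent satisfies
  \<open>R y = p (n\<^sup>* (p' (g\<^sup>* y)))\<close>, so both sides vanish.\<close>

lemma densely_defined_ext: "linear_op C \<Longrightarrow> densely_defined (ext C)"
  unfolding densely_defined_def
proof (rule closed_subspace_eq_UNIV)
  assume "linear_op C"
  note lin = linear_ext[OF this]
  have "subspace (Domain (ext C))"
    unfolding subspace_def
    using linear_op_zero[OF lin] linear_op_add[OF lin] linear_op_scaleR[OF lin] by blast
  then show "subspace (closure (Domain (ext C)))" by (rule subspace_closure)
  show "closed (closure (Domain (ext C)))" by simp
  fix y assume y: "\<And>u. u \<in> closure (Domain (ext C)) \<Longrightarrow> inner u y = 0"
  have orth: "cinner u y = 0" if "u \<in> Domain (ext C)" for u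
  proof -
    have "(- \<i>) *\<^sub>C u \<in> Domain (ext C)" using linear_op_scaleC[OF lin] that by blast
    then show ?thesis
      using y that closure_subset[of "Domain (ext C)"]
      by (auto simp: complex_eq_iff Im_cinner simp flip: inner_eq_Re_cinner
          simp del: cvec.scale_minus_left)
  qed
  obtain g' where g': "is_adjoint g g'" using ex_is_adjoint[OF is_res_bounded[OF g]] by blast
  obtain n' where n': "is_adjoint n n'" using ex_is_adjoint[OF n] by blast
  have "R y = p (n' (p' (g' y)))"
  proof (rule cinner_extensionality)
    fix x
    \<comment> \<open>With this \<open>h\<close> the resolvent is tested at \<open>g h = x\<close>,
      so that \<open>x\<close> is arbitrary.\<close>
    define h where "h = x - z *\<^sub>C R x"
    have "g h = x" unfolding h_def by (rule is_res_left[OF g])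
    then have "(h, R x - g (p (n (p' x)))) \<in> resolvent (ext C) z" by (simp add: resolvent_ext)
    then have "R x - g (p (n (p' x))) \<in> Domain (ext C)" by (auto simp: mem_resolvent)
    from orth[OF this] show "cinner x (R y) = cinner x (p (n' (p' (g' y))))"
      by (simp add: cinner_simps is_adjointD[OF adj_R] is_adjointD[OF g'] is_adjointD[OF n']
          is_adjointD[OF adj_p] is_adjointD'[OF adj_p])
  qed
  then have "R y + p (- n' (p' (g' y))) = 0" by (simp add: fun_simps)
  then show "y = 0" using direct by blast
qed

end

section \<open>Krein's formula and identification of the realisation\<close>

text \<open>M(z) differs from Lambda by a bounded operator, so B + M(z) is as closed as
  \<open>C\<close> is and taking the closure changes nothing.\<close>

lemma Q_set_iff:
  assumes C: "closed C" "C = B_op \<alpha> \<beta> +\<^sub>o \<Lambda>" and g: "is_res z g"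
  shows BM_closure_eq: "BM_closure A\<^sub>0 P \<Lambda> \<alpha> \<beta> z = C +\<^sub>o op_graph (\<lambda>\<phi>. z *\<^sub>C p' (g (p \<phi>)))"
    and "z \<in> Q_set A\<^sub>0 P \<Lambda> \<alpha> \<beta> \<longleftrightarrow> z \<in> resolvent_set A\<^sub>0 \<and>
      bounded_everywhere ((C +\<^sub>o op_graph (\<lambda>\<phi>. z *\<^sub>C p' (g (p \<phi>))))\<inverse>)"
proof -
  have "B_op \<alpha> \<beta> +\<^sub>o M_fun A\<^sub>0 P \<Lambda> z = C +\<^sub>o op_graph (\<lambda>\<phi>. z *\<^sub>C p' (g (p \<phi>)))"
    unfolding M_fun_eq[OF g] C(2) op_plus_def by (force simp: add.assoc)
  moreover have "closed (C +\<^sub>o op_graph (\<lambda>\<phi>. z *\<^sub>C p' (g (p \<phi>))))"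
    by (intro closed_plus_graph C bounded_clinear_scale bounded_clinear_compose[OF p']
        bounded_clinear_compose[OF is_res_bounded[OF g]] p)
  ultimately show eq: "BM_closure A\<^sub>0 P \<Lambda> \<alpha> \<beta> z = C +\<^sub>o op_graph (\<lambda>\<phi>. z *\<^sub>C p' (g (p \<phi>)))"
    by (simp add: BM_closure_def)
  have "resolvent T 0 = T\<inverse>" for T :: "('e, 'e) lop"
    by (auto simp: mem_resolvent)
  then show "z \<in> Q_set A\<^sub>0 P \<Lambda> \<alpha> \<beta> \<longleftrightarrow> z \<in> resolvent_set A\<^sub>0 \<and>
      bounded_everywhere ((C +\<^sub>o op_graph (\<lambda>\<phi>. z *\<^sub>C p' (g (p \<phi>))))\<inverse>)"
    unfolding Q_set_def eq[symmetric] by (simp add: resolvent_set_def)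
qed

lemma Q_setE:
  assumes C: "closed C" "C = B_op \<alpha> \<beta> +\<^sub>o \<Lambda>" and "z \<in> Q_set A\<^sub>0 P \<Lambda> \<alpha> \<beta>"
  obtains g n where "is_res z g" "bounded_clinear n"
    "(C +\<^sub>o op_graph (\<lambda>\<phi>. z *\<^sub>C p' (g (p \<phi>))))\<inverse> = op_graph n"
    "(BM_closure A\<^sub>0 P \<Lambda> \<alpha> \<beta> z)\<inverse> = op_graph n"
proof -
  have "z \<in> resolvent_set A\<^sub>0" using assms(3) by (simp add: Q_set_def)
  then obtain g where g: "is_res z g" by (rule ex_is_res)
  have "bounded_everywhere ((C +\<^sub>o op_graph (\<lambda>\<phi>. z *\<^sub>C p' (g (p \<phi>))))\<inverse>)"
    using assms(3) Q_set_iff(2)[OF C g] by blast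
  then obtain n where n: "bounded_clinear n"
    "(C +\<^sub>o op_graph (\<lambda>\<phi>. z *\<^sub>C p' (g (p \<phi>))))\<inverse> = op_graph n"
    by (rule bounded_everywhereE)
  with that[OF g n] show ?thesis by (simp add: BM_closure_eq[OF C g])
qed

text \<open>\<open>ext C\<close> has all the required properties, and any competitor shares its
  resolvent at \<open>z0\<close>. The point \<open>z0\<close> makes the quantified resolvent
  condition determine the operator.\<close>

lemma realisation_eq_ext:
  assumes \<Lambda>: "linear_op \<Lambda>" and C: "linear_op C" "closed C" "C = B_op \<alpha> \<beta> +\<^sub>o \<Lambda>"
    and z0: "z0 \<in> Q_set A\<^sub>0 P \<Lambda> \<alpha> \<beta>"
  shows "realisation A\<^sub>0 P \<Lambda> \<alpha> \<beta> = ext C"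
proof -
  have krein: "z \<in> resolvent_set (ext C) \<and> resolvent (ext C) z = resolvent A\<^sub>0 z -\<^sub>o
         (Id -\<^sub>o z *\<^sub>o A\<^sub>0\<inverse>)\<inverse> \<circ>\<^sub>o P \<circ>\<^sub>o (BM_closure A\<^sub>0 P \<Lambda> \<alpha> \<beta> z)\<inverse>
           \<circ>\<^sub>o adjoint_op P \<circ>\<^sub>o (Id -\<^sub>o z *\<^sub>o A\<^sub>0\<inverse>)\<inverse>"
    if z: "z \<in> Q_set A\<^sub>0 P \<Lambda> \<alpha> \<beta>" for z
  proof -
    obtain g n where gn: "is_res z g" "bounded_clinear n"
      "(C +\<^sub>o op_graph (\<lambda>\<phi>. z *\<^sub>C p' (g (p \<phi>))))\<inverse> = op_graph n"
      and BM: "(BM_closure A\<^sub>0 P \<Lambda> \<alpha> \<beta> z)\<inverse> = op_graph n"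
      by (rule Q_setE[OF C(2,3) z])
    show ?thesis
      unfolding BM
      unfolding resolvent_ext[OF gn] resolvent_A0[OF gn(1)] Id_minus_inverse[OF gn(1)] P_eq
        adjoint_op_graph[OF adj_p] op_comp_graph op_minus_graph
      using resolvent_set_ext[OF gn] by simp
  qed
  obtain g n where gn: "is_res z0 g" "bounded_clinear n"
      "(C +\<^sub>o op_graph (\<lambda>\<phi>. z0 *\<^sub>C p' (g (p \<phi>))))\<inverse> = op_graph n"
    by (rule Q_setE[OF C(2,3) z0])
  have tilde: "A_tilde A\<^sub>0 P \<Lambda> \<subseteq> ext C"
  proof (rule subrelI)
    fix u f assume "(u, f) \<in> A_tilde A\<^sub>0 P \<Lambda>"
    then have u: "u = R f" and "(u, 0) \<in> Gamma1 A\<^sub>0 P \<Lambda>"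
      by (auto simp: A_tilde_def op_ker_def mem_A0)
    then obtain f' \<phi> l where *: "u = R f' + p \<phi>" "0 = p' f' + l" "(\<phi>, l) \<in> \<Lambda>"
      unfolding Gamma1_def A0_inv P_eq adjoint_op_graph[OF adj_p] by auto
    \<comment> \<open>Comparing coordinates gives \<open>\<phi> = 0\<close>, hence
      \<open>l = 0\<close>; the kernel condition thus becomes \<open>p' f = 0\<close>, the condition
      in \<open>ext C\<close> at \<phi> = 0.\<close>
    have "R f + p 0 = R f' + p \<phi>" using u *(1) by (simp add: fun_simps)
    from direct_eq[OF this] have "f' = f" "\<phi> = 0" by simp_all
    with * have "p' f = 0" using linear_op_single_valued[OF \<Lambda> _ linear_op_zero[OF \<Lambda>]] by force
    then show "(u, f) \<in> ext C"
      unfolding mem_ext using u linear_op_zero[OF C(1)] by (intro exI[of _ 0]) (simp add: fun_simps)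
  qed
  have A: "ext C \<subseteq> A_op A\<^sub>0 P"
    unfolding ext_def A_op_def A0_inv P_eq by auto
  show ?thesis
    unfolding realisation_def
  proof (rule the_equality)
    show "linear_op (ext C) \<and> closed (ext C) \<and> densely_defined (ext C) \<and>
      A_tilde A\<^sub>0 P \<Lambda> \<subseteq> ext C \<and> ext C \<subseteq> A_op A\<^sub>0 P \<and>
      (\<forall>z \<in> Q_set A\<^sub>0 P \<Lambda> \<alpha> \<beta>. z \<in> resolvent_set (ext C) \<and>
       resolvent (ext C) z = resolvent A\<^sub>0 z -\<^sub>o
         (Id -\<^sub>o z *\<^sub>o A\<^sub>0\<inverse>)\<inverse> \<circ>\<^sub>o P \<circ>\<^sub>o (BM_closure A\<^sub>0 P \<Lambda> \<alpha> \<beta> z)\<inverse>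
           \<circ>\<^sub>o adjoint_op P \<circ>\<^sub>o (Id -\<^sub>o z *\<^sub>o A\<^sub>0\<inverse>)\<inverse>)"
      using linear_ext[OF gn C(1)] closed_ext[OF gn] densely_defined_ext[OF gn C(1)] tilde A krein
      by blast
  next
    fix T
    assume "linear_op T \<and> closed T \<and> densely_defined T \<and>
      A_tilde A\<^sub>0 P \<Lambda> \<subseteq> T \<and> T \<subseteq> A_op A\<^sub>0 P \<and>
      (\<forall>z \<in> Q_set A\<^sub>0 P \<Lambda> \<alpha> \<beta>. z \<in> resolvent_set T \<and>
       resolvent T z = resolvent A\<^sub>0 z -\<^sub>o
         (Id -\<^sub>o z *\<^sub>o A\<^sub>0\<inverse>)\<inverse> \<circ>\<^sub>o P \<circ>\<^sub>o (BM_closure A\<^sub>0 P \<Lambda> \<alpha> \<beta> z)\<inverse>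
           \<circ>\<^sub>o adjoint_op P \<circ>\<^sub>o (Id -\<^sub>o z *\<^sub>o A\<^sub>0\<inverse>)\<inverse>)"
    with z0 krein[OF z0] have "resolvent T z0 = resolvent (ext C) z0" by simp
    then show "T = ext C" by (rule resolvent_inj)
  qed
qed

text \<open>One inclusion is Green's identity in coordinates. For the other, surjectivity of ext D -
  z and ext C - cnj z shows that the adjoint cannot extend \<open>ext D\<close> properly.\<close>

lemma adjoint_ext:
  assumes sym: "\<And>\<phi> w \<psi> v. (\<phi>, w) \<in> C \<Longrightarrow> (\<psi>, v) \<in> D \<Longrightarrow> cinner w \<psi> = cinner \<phi> v"
    and C: "cnj z \<in> resolvent_set (ext C)" and D: "z \<in> resolvent_set (ext D)"
  shows "adjoint_op (ext C) = ext D"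
proof
  show sub: "ext D \<subseteq> adjoint_op (ext C)"
  proof (rule subrelI)
    fix v f' assume "(v, f') \<in> ext D"
    then obtain \<psi> where v: "v = R f' + p \<psi>" "(\<psi>, - p' f') \<in> D" by (rule extE)
    have "cinner f v = cinner u f'" if uf: "(u, f) \<in> ext C" for u f
    proof -
      obtain \<phi> where u: "u = R f + p \<phi>" "(\<phi>, - p' f) \<in> C" using uf by (rule extE)
      have "cinner (p' f) \<psi> = cinner \<phi> (p' f')"
        using sym[OF u(2) v(2)] by (simp add: cinner_simps)
      then show ?thesis
        by (simp add: u(1) v(1) cinner_simps is_adjointD[OF adj_R] is_adjointD[OF adj_p]
            is_adjointD'[OF adj_p, symmetric])
    qed
    then show "(v, f') \<in> adjoint_op (ext C)" by (auto simp: adjoint_op_def)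
  qed
  show "adjoint_op (ext C) \<subseteq> ext D"
  proof (rule subrelI)
    fix y x' assume yx: "(y, x') \<in> adjoint_op (ext C)"
    have dom: "w \<in> resolvent_set T \<Longrightarrow> h \<in> Domain (resolvent T w)" for T :: "('h, 'h) lop" and w h
      by (simp add: resolvent_set_def bounded_everywhere_def)
    \<comment> \<open>\<open>u\<close> is chosen so that the adjoint of \<open>ext C\<close> maps
      \<open>y - u\<close> to z (y - u); \<open>a\<close> is a preimage of \<open>y - u\<close>
      under ext C - cnj z, and pairing the two leaves the squared norm of \<open>y - u\<close> equal
      to 0.\<close>
    obtain u where u: "(u, x' - z *\<^sub>C y + z *\<^sub>C u) \<in> ext D"
      using dom[OF D, of "x' - z *\<^sub>C y"] by (auto simp: mem_resolvent)
    obtain a where a: "(a, (y - u) + cnj z *\<^sub>C a) \<in> ext C"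
      using dom[OF C, of "y - u"] by (auto simp: mem_resolvent)
    have adjD: "cinner b' d = cinner b d'" if "(d, d') \<in> adjoint_op (ext C)" "(b, b') \<in> ext C" for b b' d d'
      using that by (auto simp: adjoint_op_def)
    have "cinner ((y - u) + cnj z *\<^sub>C a) (y - u) = cinner a (x' - (x' - z *\<^sub>C y + z *\<^sub>C u))"
      using adjD[OF yx a] adjD[OF subsetD[OF sub u] a] by (simp only: cinner_diff_right)
    then have "cinner (y - u) (y - u) = 0"
      by (simp add: cinner_simps algebra_simps)
    then have "y = u" by (simp add: cinner_self)
    with u show "(y, x') \<in> ext D" by simp
  qed
qed

section \<open>Invertibility of M(z) + c in the half-planes\<close>

text \<open>For x = g (p \<phi>) one has p \<phi> = x - z R x. The form is therefore z times the
  squared norm of x, minus |z|^2 times the real number \<open>cinner x (R x)\<close>.\<close>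

lemma Im_M_fun:
  assumes g: "is_res z g"
  shows "Im (cinner (z *\<^sub>C p' (g (p \<phi>))) \<phi>) = Im z * (norm (g (p \<phi>)))\<^sup>2"
proof -
  define x where "x = g (p \<phi>)"
  have "cinner (R x) x = cinner x (R x)" by (rule is_adjointD[OF adj_R])
  then have real: "Im (cinner x (R x)) = 0"
    using cinner_commute[of x "R x"] by (simp add: complex_eq_iff)
  have "cinner (z *\<^sub>C p' x) \<phi> = z * cinner x (x - z *\<^sub>C R x)"
    by (simp add: cinner_scaleC_left is_adjointD'[OF adj_p] x_def is_res_right[OF g])
  also have "\<dots> = z * complex_of_real ((norm x)\<^sup>2) - z * cnj z * cinner x (R x)"
    by (simp add: cinner_diff_right cinner_scaleC_right cinner_self algebra_simps del: of_real_power)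
  finally show ?thesis
    using real by (simp add: x_def[symmetric] complex_mult_cnj del: of_real_power)
qed

text \<open>Im z and Im c have the same sign, so the two contributions to the imaginary part cannot
  cancel. The first form of the inverse suits \<open>ext\<close>, the second suits the
  characteristic function.\<close>

lemma M_fun_invertible:
  assumes \<Lambda>: "selfadjoint_op \<Lambda>" and g: "is_res z g" and c: "0 < Im z * Im c"
  obtains n where "bounded_clinear n"
    "(c *\<^sub>o Id +\<^sub>o \<Lambda> +\<^sub>o op_graph (\<lambda>\<phi>. z *\<^sub>C p' (g (p \<phi>))))\<inverse> = op_graph n"
    "(M_fun A\<^sub>0 P \<Lambda> z +\<^sub>o c *\<^sub>o Id)\<inverse> = op_graph n"
proof -
  let ?k = "\<lambda>\<phi>. z *\<^sub>C p' (g (p \<phi>)) + c *\<^sub>C \<phi>"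
  have "bounded_everywhere ((\<Lambda> +\<^sub>o op_graph ?k)\<inverse>)"
  proof (rule selfadjoint_perturbation_invertible[OF \<Lambda>])
    show "bounded_clinear ?k"
      by (intro bounded_clinear_plus bounded_clinear_scale bounded_clinear_compose[OF p']
        bounded_clinear_compose[OF is_res_bounded[OF g]] p bounded_clinear_ident)
    show "0 < \<bar>Im c\<bar>" using c by auto
    fix \<phi>
    have "Im (cinner (?k \<phi>) \<phi>) = Im z * (norm (g (p \<phi>)))\<^sup>2 + Im c * (norm \<phi>)\<^sup>2"
      unfolding cinner_add_left plus_complex.sel Im_M_fun[OF g]
      by (simp add: cinner_scaleC_left cinner_self del: of_real_power)
    moreover have "\<bar>Im c\<bar> * t \<le> \<bar>Im z * s + Im c * t\<bar>" if "0 \<le> s" "0 \<le> t" for s t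
    proof (cases "0 < Im c")
      case True
      then have "0 \<le> Im z * s" "0 \<le> Im c * t" using c that by (auto simp: zero_less_mult_iff)
      with True show ?thesis by simp
    next
      case False
      then have "Im z < 0" "Im c < 0" using c by (auto simp: zero_less_mult_iff)
      then have "Im z * s \<le> 0" "Im c * t \<le> 0" using that by (auto simp: mult_le_0_iff)
      with \<open>Im c < 0\<close> show ?thesis by simp
    qed
    ultimately show "\<bar>Im c\<bar> * (norm \<phi>)\<^sup>2 \<le> \<bar>Im (cinner (?k \<phi>) \<phi>)\<bar>" by simp
  qed
  then obtain n where n: "bounded_clinear n" "(\<Lambda> +\<^sub>o op_graph ?k)\<inverse> = op_graph n"
    by (rule bounded_everywhereE)
  have "c *\<^sub>o Id +\<^sub>o \<Lambda> +\<^sub>o op_graph (\<lambda>\<phi>. z *\<^sub>C p' (g (p \<phi>))) = \<Lambda> +\<^sub>o op_graph ?k"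
    and "M_fun A\<^sub>0 P \<Lambda> z +\<^sub>o c *\<^sub>o Id = \<Lambda> +\<^sub>o op_graph ?k"
    unfolding M_fun_eq[OF g] Id_eq_graph op_scale_graph
    by (force simp: op_plus_def op_graph_def add_ac)+
  with n that show ?thesis by simp
qed

lemma
  fixes \<Lambda> :: "('e, 'e) lop"
  assumes "selfadjoint_op \<Lambda>"
  shows linear_shift: "linear_op (c *\<^sub>o Id +\<^sub>o \<Lambda>)" and closed_shift: "closed (c *\<^sub>o Id +\<^sub>o \<Lambda>)"
proof -
  have *: "bounded_everywhere (c *\<^sub>o Id :: ('e, 'e) lop)"
    unfolding Id_eq_graph op_scale_graph
    by (intro bounded_everywhere_op_graph bounded_clinear_scale bounded_clinear_ident)
  then show "linear_op (c *\<^sub>o Id +\<^sub>o \<Lambda>)"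
    by (intro linear_op_plus selfadjoint_op_linear[OF assms]) (simp add: bounded_everywhere_def)
  from * show "closed (c *\<^sub>o Id +\<^sub>o \<Lambda>)"
    using selfadjoint_op_closed[OF assms] unfolding bounded_everywhere_def
    by (intro closed_bounded_plus) auto
qed

text \<open>The parameter of \<open>L_op\<close> has negative imaginary part, so z = -i serves as
  the point that shows its \<open>Q_set\<close> to be nonempty.\<close>

lemma L_op_eq_ext:
  assumes A0: "selfadjoint_op A\<^sub>0" and \<Lambda>: "selfadjoint_op \<Lambda>"
  shows "L_op A\<^sub>0 P \<Lambda> = ext ((- \<i>) *\<^sub>o Id +\<^sub>o \<Lambda>)"
proof -
  let ?C = "(- \<i>) *\<^sub>o Id +\<^sub>o \<Lambda>"
  have B: "?C = B_op ((- \<i>) *\<^sub>o Id) Id +\<^sub>o \<Lambda>" by (simp add: B_op_def)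
  have z: "- \<i> \<in> resolvent_set A\<^sub>0" by (rule nonreal_in_resolvent_set[OF A0]) simp
  then obtain g where g: "is_res (- \<i>) g" by (rule ex_is_res)
  obtain n where n: "bounded_clinear n"
    "(?C +\<^sub>o op_graph (\<lambda>\<phi>. (- \<i>) *\<^sub>C p' (g (p \<phi>))))\<inverse> = op_graph n"
    by (rule M_fun_invertible[OF \<Lambda> g, of "- \<i>"]) simp_all
  have "bounded_everywhere ((?C +\<^sub>o op_graph (\<lambda>\<phi>. (- \<i>) *\<^sub>C p' (g (p \<phi>))))\<inverse>)"
    unfolding n(2) by (rule bounded_everywhere_op_graph[OF n(1)])
  then have "- \<i> \<in> Q_set A\<^sub>0 P \<Lambda> ((- \<i>) *\<^sub>o Id) Id"
    using Q_set_iff(2)[OF closed_shift[OF \<Lambda>] B g] z by blast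
  then show ?thesis
    unfolding L_op_def
    by (rule realisation_eq_ext[OF selfadjoint_op_linear[OF \<Lambda>] linear_shift[OF \<Lambda>]
          closed_shift[OF \<Lambda>] B])
qed

lemma shift_adjoint:
  assumes "selfadjoint_op \<Lambda>" "(\<phi>, w) \<in> c *\<^sub>o Id +\<^sub>o \<Lambda>" "(\<psi>, v) \<in> cnj c *\<^sub>o Id +\<^sub>o \<Lambda>"
  shows "cinner w \<psi> = cinner \<phi> v"
proof -
  obtain w' v' where *: "(\<phi>, w') \<in> \<Lambda>" "w = c *\<^sub>C \<phi> + w'" "(\<psi>, v') \<in> \<Lambda>" "v = cnj c *\<^sub>C \<psi> + v'"
    using assms(2,3) by (auto simp: op_plus_def op_scale_def)
  with selfadjoint_op_sym[OF assms(1) *(1,3)] show ?thesis by (simp add: cinner_simps)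
qed

section \<open>The factor formulas\<close>

text \<open>The cancellation behind both formulas, with c = 2i for \<open>Theta\<close> and c = -2i
  for \<open>Theta_hat\<close>. The unbounded inverse meets only vectors in the range of
  \<open>n\<close>, where it returns \<open>q h\<close> divided by \<open>c\<close>; the outer
  factor \<open>c\<close> cancels, so both sides have full domain.\<close>

lemma theta_comp:
  fixes C :: "('e, 'e) lop"
  assumes C: "linear_op C" and n: "bounded_clinear n" and inv: "C\<inverse> = op_graph n"
    and m: "bounded_clinear m" and "c \<noteq> 0"
  shows "(c *\<^sub>o (((- 1) *\<^sub>o op_graph m) \<circ>\<^sub>o (op_graph (\<lambda>x. (- c) *\<^sub>C n x))\<inverse>)) \<circ>\<^sub>o
      op_graph (\<lambda>h. - n (q h)) = op_graph (\<lambda>h. - m (q h))"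
proof -
  \<comment> \<open>\<open>n\<close> is injective as the inverse of a single-valued
    operator.\<close>
  have "x = y" if "n x = n y" for x y
    using inv that linear_op_single_valued[OF C, of "n x" x y] by (metis converse_iff mem_op_graph)
  then have inj: "- n (q h) = (- c) *\<^sub>C n x \<longleftrightarrow> c *\<^sub>C x = q h" for h x
    using bounded_clinear_scaleC[OF n, of c x] by (auto simp: cvec.scale_minus_left)
  have "inverse c *\<^sub>C c *\<^sub>C x = x" "c *\<^sub>C inverse c *\<^sub>C x = x" for x :: 'e
    using \<open>c \<noteq> 0\<close> by simp_all
  then have eq: "c *\<^sub>C x = q h \<longleftrightarrow> x = inverse c *\<^sub>C q h" for x h
    by metis
  have "(h, \<phi>) \<in> (c *\<^sub>o (((- 1) *\<^sub>o op_graph m) \<circ>\<^sub>o (op_graph (\<lambda>x. (- c) *\<^sub>C n x))\<inverse>)) \<circ>\<^sub>o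
      op_graph (\<lambda>h. - n (q h)) \<longleftrightarrow>
      (\<exists>x. - n (q h) = (- c) *\<^sub>C n x \<and> \<phi> = c *\<^sub>C (- 1) *\<^sub>C m x)" for h \<phi>
    unfolding op_scale_def op_graph_def by blast
  also have "\<dots> h \<phi> \<longleftrightarrow> \<phi> = - m (q h)" for h \<phi>
    unfolding inj eq using \<open>c \<noteq> 0\<close> by (simp add: bounded_clinear_scaleC[OF m])
  finally show ?thesis by (auto simp: op_graph_def)
qed

lemma Gamma0_realisation:
  assumes \<Lambda>: "linear_op \<Lambda>" and C: "linear_op C" "closed C" "C = B_op \<alpha> \<beta> +\<^sub>o \<Lambda>"
    and z: "z \<in> Q_set A\<^sub>0 P \<Lambda> \<alpha> \<beta>"
  obtains g m where "is_res z g" "bounded_clinear m"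
    "Q_fun A\<^sub>0 P \<Lambda> \<alpha> \<beta> z = (- 1) *\<^sub>o op_graph m"
    "Gamma0 A\<^sub>0 P \<circ>\<^sub>o resolvent (realisation A\<^sub>0 P \<Lambda> \<alpha> \<beta>) z = op_graph (\<lambda>h. - m (p' (g h)))"
proof -
  obtain g m where gm: "is_res z g" "bounded_clinear m"
    "(C +\<^sub>o op_graph (\<lambda>\<phi>. z *\<^sub>C p' (g (p \<phi>))))\<inverse> = op_graph m"
    and BM: "(BM_closure A\<^sub>0 P \<Lambda> \<alpha> \<beta> z)\<inverse> = op_graph m"
    by (rule Q_setE[OF C(2,3) z])
  show ?thesis
    by (rule that[OF gm(1,2)])
      (simp_all add: Q_fun_def BM realisation_eq_ext[OF \<Lambda> C z] Gamma0_resolvent_ext[OF gm])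
qed

text \<open>This transfers formal adjointness of M(cnj z) + i and M(z) - i to their inverses, as
  needed to evaluate \<open>S_star\<close>.\<close>

lemma is_adjoint_inverse:
  assumes sym: "\<And>x y x' y'. (x, y) \<in> S \<Longrightarrow> (x', y') \<in> T \<Longrightarrow> cinner y x' = cinner x y'"
    and "S\<inverse> = op_graph n" "T\<inverse> = op_graph n'"
  shows "is_adjoint n n'"
proof -
  have "(n x, x) \<in> S" "(n' y, y) \<in> T" for x y
    using assms(2,3) by (metis converse_iff mem_op_graph)+
  then show ?thesis using sym unfolding is_adjoint_def by metis
qed

lemma linear_M_shift:
  assumes "selfadjoint_op \<Lambda>" "is_res z g"
  shows "linear_op (c *\<^sub>o Id +\<^sub>o \<Lambda> +\<^sub>o op_graph (\<lambda>\<phi>. z *\<^sub>C p' (g (p \<phi>))))"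
  by (intro linear_op_plus[OF linear_shift] linear_op_graph assms bounded_clinear_scale
      bounded_clinear_compose[OF p'] bounded_clinear_compose[OF is_res_bounded[OF assms(2)]] p)

lemma Theta_formula:
  assumes A0: "selfadjoint_op A\<^sub>0" and \<Lambda>: "selfadjoint_op \<Lambda>"
    and C: "linear_op C" "closed C" "C = B_op \<alpha> \<beta> +\<^sub>o \<Lambda>"
    and z: "Im z < 0" "z \<in> Q_set A\<^sub>0 P \<Lambda> \<alpha> \<beta>"
  shows "Gamma0 A\<^sub>0 P \<circ>\<^sub>o resolvent (realisation A\<^sub>0 P \<Lambda> \<alpha> \<beta>) z =
    (Theta A\<^sub>0 P \<Lambda> \<alpha> \<beta> z)\<inverse> \<circ>\<^sub>o Gamma0 A\<^sub>0 P \<circ>\<^sub>o resolvent (L_op A\<^sub>0 P \<Lambda>) z"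
proof -
  obtain g m where g: "is_res z g" and m: "bounded_clinear m"
    and Q: "Q_fun A\<^sub>0 P \<Lambda> \<alpha> \<beta> z = (- 1) *\<^sub>o op_graph m"
    and lhs: "Gamma0 A\<^sub>0 P \<circ>\<^sub>o resolvent (realisation A\<^sub>0 P \<Lambda> \<alpha> \<beta>) z = op_graph (\<lambda>h. - m (p' (g h)))"
    by (rule Gamma0_realisation[OF selfadjoint_op_linear[OF \<Lambda>] C z(2)])
  obtain n where n: "bounded_clinear n"
    "((- \<i>) *\<^sub>o Id +\<^sub>o \<Lambda> +\<^sub>o op_graph (\<lambda>\<phi>. z *\<^sub>C p' (g (p \<phi>))))\<inverse> = op_graph n"
    by (rule M_fun_invertible[OF \<Lambda> g, of "- \<i>"]) (use z in simp_all)
  \<comment> \<open>\<open>S_star\<close> is the adjoint of a value of \<open>S_fun\<close> in the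
    upper half-plane, so M + i is first inverted at \<open>cnj z\<close>.\<close>
  have "cnj z \<in> resolvent_set A\<^sub>0" using z by (intro nonreal_in_resolvent_set[OF A0]) simp
  then obtain g' where g': "is_res (cnj z) g'" by (rule ex_is_res)
  obtain n' where n': "bounded_clinear n'"
    "(\<i> *\<^sub>o Id +\<^sub>o \<Lambda> +\<^sub>o op_graph (\<lambda>\<phi>. cnj z *\<^sub>C p' (g' (p \<phi>))))\<inverse> = op_graph n'"
    "(M_fun A\<^sub>0 P \<Lambda> (cnj z) +\<^sub>o \<i> *\<^sub>o Id)\<inverse> = op_graph n'"
    by (rule M_fun_invertible[OF \<Lambda> g', of "\<i>"]) (use z in simp_all)
  have "is_adjoint n' n"
  proof (rule is_adjoint_inverse[OF _ n'(2) n(2)])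
    fix x y x' y'
    assume "(x, y) \<in> \<i> *\<^sub>o Id +\<^sub>o \<Lambda> +\<^sub>o op_graph (\<lambda>\<phi>. cnj z *\<^sub>C p' (g' (p \<phi>)))"
      "(x', y') \<in> (- \<i>) *\<^sub>o Id +\<^sub>o \<Lambda> +\<^sub>o op_graph (\<lambda>\<phi>. z *\<^sub>C p' (g (p \<phi>)))"
    then have "cinner (y - cnj z *\<^sub>C p' (g' (p x))) x' = cinner x (y' - z *\<^sub>C p' (g (p x')))"
      using shift_adjoint[OF \<Lambda>, of x _ \<i> x'] by simp
    moreover have "cinner (p' (g' (p x))) x' = cinner x (p' (g (p x')))"
      using is_adjointD'[OF is_res_adjoint[OF g g']]
      by (simp add: is_adjointD[OF adj_p, symmetric] is_adjointD'[OF adj_p])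
    ultimately show "cinner y x' = cinner x y'" by (simp add: cinner_simps)
  qed
  then have adj: "is_adjoint (\<lambda>x. x - (2 * \<i>) *\<^sub>C n' x) (\<lambda>x. x + (2 * \<i>) *\<^sub>C n x)"
    by (simp add: is_adjoint_def cinner_simps)
  have "S_star A\<^sub>0 P \<Lambda> (cnj z) = op_graph (\<lambda>x. x + (2 * \<i>) *\<^sub>C n x)"
    unfolding S_star_def S_fun_def n'(3)
    unfolding op_scale_graph Id_eq_graph op_minus_graph
    by (rule adjoint_op_graph[OF adj])
  \<comment> \<open>In the shape required by \<open>theta_comp\<close> with c = 2i.\<close>
  then have S: "Id -\<^sub>o S_star A\<^sub>0 P \<Lambda> (cnj z) = op_graph (\<lambda>x. (- (2 * \<i>)) *\<^sub>C n x)"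
    by (simp add: Id_eq_graph op_minus_graph cvec.scale_minus_left)
  show ?thesis
    unfolding lhs L_op_eq_ext[OF A0 \<Lambda>] Gamma0_resolvent_ext[OF g n] Theta_def Q S converse_converse
    by (rule theta_comp[OF linear_M_shift[OF \<Lambda> g] n m, symmetric]) simp
qed

lemma Theta_hat_formula:
  assumes A0: "selfadjoint_op A\<^sub>0" and \<Lambda>: "selfadjoint_op \<Lambda>"
    and C: "linear_op C" "closed C" "C = B_op \<alpha> \<beta> +\<^sub>o \<Lambda>"
    and z: "0 < Im z" "z \<in> Q_set A\<^sub>0 P \<Lambda> \<alpha> \<beta>"
  shows "Gamma0 A\<^sub>0 P \<circ>\<^sub>o resolvent (realisation A\<^sub>0 P \<Lambda> \<alpha> \<beta>) z =
    (Theta_hat A\<^sub>0 P \<Lambda> \<alpha> \<beta> z)\<inverse> \<circ>\<^sub>o Gamma0 A\<^sub>0 P \<circ>\<^sub>o resolvent (adjoint_op (L_op A\<^sub>0 P \<Lambda>)) z"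
proof -
  obtain g m where g: "is_res z g" and m: "bounded_clinear m"
    and Q: "Q_fun A\<^sub>0 P \<Lambda> \<alpha> \<beta> z = (- 1) *\<^sub>o op_graph m"
    and lhs: "Gamma0 A\<^sub>0 P \<circ>\<^sub>o resolvent (realisation A\<^sub>0 P \<Lambda> \<alpha> \<beta>) z = op_graph (\<lambda>h. - m (p' (g h)))"
    by (rule Gamma0_realisation[OF selfadjoint_op_linear[OF \<Lambda>] C z(2)])
  obtain n where n: "bounded_clinear n"
    "(\<i> *\<^sub>o Id +\<^sub>o \<Lambda> +\<^sub>o op_graph (\<lambda>\<phi>. z *\<^sub>C p' (g (p \<phi>))))\<inverse> = op_graph n"
    and M: "(M_fun A\<^sub>0 P \<Lambda> z +\<^sub>o \<i> *\<^sub>o Id)\<inverse> = op_graph n"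
    by (rule M_fun_invertible[OF \<Lambda> g, of "\<i>"]) (use z in simp_all)
  have "cnj z \<in> resolvent_set A\<^sub>0" using z by (intro nonreal_in_resolvent_set[OF A0]) simp
  then obtain g' where g': "is_res (cnj z) g'" by (rule ex_is_res)
  obtain n' where n': "bounded_clinear n'"
    "((- \<i>) *\<^sub>o Id +\<^sub>o \<Lambda> +\<^sub>o op_graph (\<lambda>\<phi>. cnj z *\<^sub>C p' (g' (p \<phi>))))\<inverse> = op_graph n'"
    by (rule M_fun_invertible[OF \<Lambda> g', of "- \<i>"]) (use z in simp_all)
  \<comment> \<open>The adjoint is identified through the resolvent of \<open>L_op\<close> at
    \<open>cnj z\<close> and that of the candidate at \<open>z\<close>.\<close>
  have L: "adjoint_op (L_op A\<^sub>0 P \<Lambda>) = ext (\<i> *\<^sub>o Id +\<^sub>o \<Lambda>)"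
    unfolding L_op_eq_ext[OF A0 \<Lambda>]
  proof (rule adjoint_ext[OF _ resolvent_set_ext[OF g' n'] resolvent_set_ext[OF g n]])
    fix \<phi> w \<psi> v assume "(\<phi>, w) \<in> (- \<i>) *\<^sub>o Id +\<^sub>o \<Lambda>" "(\<psi>, v) \<in> \<i> *\<^sub>o Id +\<^sub>o \<Lambda>"
    then show "cinner w \<psi> = cinner \<phi> v" using shift_adjoint[OF \<Lambda>, of \<phi> w "- \<i>" \<psi> v] by simp
  qed
  \<comment> \<open>The double sign matches \<open>theta_comp\<close> with c = -2i.\<close>
  have S: "Id -\<^sub>o S_fun A\<^sub>0 P \<Lambda> z = op_graph (\<lambda>x. (- (- 2 * \<i>)) *\<^sub>C n x)"
    unfolding S_fun_def M
    unfolding op_scale_graph Id_eq_graph op_minus_graph by simp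
  show ?thesis
    unfolding lhs L Gamma0_resolvent_ext[OF g n] Theta_hat_def Q S converse_converse
    by (rule theta_comp[OF linear_M_shift[OF \<Lambda> g] n m, symmetric]) simp
qed

end


theorem lemma5p4:
  fixes A\<^sub>0 :: "('h::chilbert_space, 'h) lop"
    and P :: "('e::chilbert_space, 'h) lop"
    and \<Lambda> \<alpha> \<beta> :: "('e, 'e) lop"
  assumes "separable_space (euclidean :: 'h topology)"
    and "selfadjoint_op A\<^sub>0" and "0 \<in> resolvent_set A\<^sub>0"
    and "bounded_everywhere P" and "Domain A\<^sub>0 \<inter> Range P = {0}" and "op_ker P = {0}"
    and "selfadjoint_op \<Lambda>"
    and "linear_op \<alpha>" and "Domain \<Lambda> \<subseteq> Domain \<alpha>"
    and "bounded_everywhere \<beta>" and "bounded_everywhere (\<beta>\<inverse>)"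
    and "closable_op (\<alpha> +\<^sub>o \<beta> \<circ>\<^sub>o \<Lambda>)"
    and "Q_set A\<^sub>0 P \<Lambda> \<alpha> \<beta> \<noteq> {}"
    and "op_bounded (B_op \<alpha> \<beta>)"
  shows "(\<forall>z \<in> \<complex>\<^sub>- \<inter> Q_set A\<^sub>0 P \<Lambda> \<alpha> \<beta>.
            Gamma0 A\<^sub>0 P \<circ>\<^sub>o resolvent (realisation A\<^sub>0 P \<Lambda> \<alpha> \<beta>) z =
            (Theta A\<^sub>0 P \<Lambda> \<alpha> \<beta> z)\<inverse> \<circ>\<^sub>o Gamma0 A\<^sub>0 P \<circ>\<^sub>o resolvent (L_op A\<^sub>0 P \<Lambda>) z) \<and>
         (\<forall>z \<in> \<complex>\<^sub>+ \<inter> Q_set A\<^sub>0 P \<Lambda> \<alpha> \<beta>.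
            Gamma0 A\<^sub>0 P \<circ>\<^sub>o resolvent (realisation A\<^sub>0 P \<Lambda> \<alpha> \<beta>) z =
            (Theta_hat A\<^sub>0 P \<Lambda> \<alpha> \<beta> z)\<inverse> \<circ>\<^sub>o Gamma0 A\<^sub>0 P \<circ>\<^sub>o
              resolvent (adjoint_op (L_op A\<^sub>0 P \<Lambda>)) z)"
proof -
  note A0 = assms(2) and \<Lambda> = assms(7)
  have "resolvent A\<^sub>0 0 = A\<^sub>0\<inverse>" by (auto simp: mem_resolvent)
  then have "bounded_everywhere (A\<^sub>0\<inverse>)" using assms(3) by (simp add: resolvent_set_def)
  then obtain R where R: "bounded_clinear R" "A\<^sub>0\<inverse> = op_graph R" by (rule bounded_everywhereE)
  obtain p where p: "bounded_clinear p" "P = op_graph p"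
    using assms(4) by (rule bounded_everywhereE)
  obtain p' where p': "bounded_clinear p'" "is_adjoint p p'" using ex_is_adjoint[OF p(1)] by blast
  have mem: "(R f, f) \<in> A\<^sub>0" for f using R(2) by (metis converse_iff mem_op_graph)
  interpret boundary_setup A\<^sub>0 P R p p'
  proof
    show "is_adjoint R R"
      unfolding is_adjoint_def using selfadjoint_op_sym[OF A0 mem mem] by simp
    fix f \<phi> assume eq: "R f + p \<phi> = 0"
    have "R f \<in> Domain A\<^sub>0" using mem by blast
    moreover have "R f = p (- \<phi>)"
      using eq by (simp add: bounded_clinear_minus[OF p(1)] eq_neg_iff_add_eq_0)
    then have "R f \<in> Range P" unfolding p(2) by (auto simp: op_graph_def)
    ultimately have "R f = 0" using assms(5) by blast
    \<comment> \<open>\<open>A\<^sub>0\<close> maps \<open>R f = 0\<close> to \<open>f\<close>, and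
      a linear operator maps 0 to 0.\<close>
    then have "f = 0"
      using mem[of f] linear_op_single_valued linear_op_zero selfadjoint_op_linear[OF A0] by metis
    moreover have "\<phi> \<in> op_ker P" using eq \<open>R f = 0\<close> by (simp add: op_ker_def p(2))
    ultimately show "f = 0 \<and> \<phi> = 0" using assms(6) by simp
  qed (use R p p' in auto)
  define C where "C = B_op \<alpha> \<beta> +\<^sub>o \<Lambda>"
  have \<beta>: "linear_op (\<beta>\<inverse>)" "Domain (\<beta>\<inverse>) = UNIV"
    using assms(11) by (auto simp: bounded_everywhere_def)
  have B: "linear_op (B_op \<alpha> \<beta>)"
    unfolding B_op_def by (intro linear_op_comp \<beta> assms)
  \<comment> \<open>The inverse of \<open>\<beta>\<close> is total, so B is defined wherever
    \<open>\<alpha>\<close> is, in particular on the domain of Lambda; this is the domain condition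
    of \<open>closed_bounded_plus\<close>.\<close>
  have "Domain \<alpha> \<subseteq> Domain (B_op \<alpha> \<beta>)" unfolding B_op_def using \<beta>(2) by blast
  then have C: "linear_op C" "closed C" "C = B_op \<alpha> \<beta> +\<^sub>o \<Lambda>"
    unfolding C_def
    using linear_op_plus[OF B selfadjoint_op_linear[OF \<Lambda>]]
      closed_bounded_plus[OF B assms(14) selfadjoint_op_closed[OF \<Lambda>]] assms(9) by auto
  show ?thesis
    using Theta_formula[OF A0 \<Lambda> C] Theta_hat_formula[OF A0 \<Lambda> C] by blast
qed

end
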